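(* Let $\varepsilon>0$ be given and assume that $2\|K\|^2\Omega>\varepsilon\omega L$. Consider the saddle point problem $$\psi^*:=\min_{x\in X}\Big\{\psi(x):=f(x)+\max_{y\in Y}\langle Kx,y\rangle-J(y)\Big\}.$$ If the AGS algorithm is applied to the smooth approximation problem $\min_{x\in X}\{\psi_\rho(x):=f(x)+h_\rho(x)\}$ (with $h=h_\rho$ and $\rho=\varepsilon/(2\Omega)$), in which the parameters are set to the AGS parameters given in the context with $M=\|K\|^2/(\rho\omega)$, then the total number of gradient evaluations of $\nabla f$ and linear operator evaluations of $K$ (and $K^T$) in order to find an $\varepsilon$-solution of the saddle point problem can be bounded by $$N_f:=3\left(\sqrt{\frac{2LV(x_0,x^* )}{\nu\varepsilon}}\right)$$ and $$N_K:=14\left(\sqrt{\frac{2LV(x_0,x^* )}{\nu\varepsilon}}+\frac{2\|K\|\sqrt{V(x_0,x^* )\Omega}}{\sqrt{\nu\omega}\,\varepsilon}\right),$$ respectively, where $x^*$ is a solution of the smooth approximation problem.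
   Context: Setting. $\mathbb{R}^n$ and $\mathbb{R}^m$ carry norms (both written $\|\cdot\|$) and inner products $\langle\cdot,\cdot\rangle$. $X\subseteq\mathbb{R}^n$, $Y\subseteq\mathbb{R}^m$ are closed convex sets; $K:\mathbb{R}^n\to\mathbb{R}^m$ is a linear operator with operator norm $\|K\|=\max\{\langle Kx,y\rangle:\|x\|\le1,\|y\|\le1\}$; $J$ is a relatively simple convex function. $f:X\to\mathbb{R}$ is continuously differentiable and convex, and $L>0$ satisfies, with $l_f(u,x):=f(u)+\langle\nabla f(u),x-u\rangle$, $$0\le f(x)-l_f(u,x)\le\tfrac{L}{2}\|x-u\|^2,\qquad\forall x,u\in X.$$ An $\varepsilon$-solution of the saddle point problem is a point $\bar x\in X$ with $\psi(\bar x)-\psi^*\le\varepsilon$. Prox-functions. A prox-function on a set $Z$ with modulus $\sigma>0$ is $D(z,u)=\pi(u)-\pi(z)-\langle\nabla\pi(z),u-z\rangle$, $z,u\in Z$, for some (differentiable) $\pi$ strongly convex with parameter $\sigma$ with respect to the given norm; so $D(z,u)\ge\frac{\sigma}{2}\|z-u\|^2$. $V$ is a prox-function on $X$ with modulus $\nu$ and $W$ a prox-function on $Y$ with modulus $\omega$. $Y$ is assumed bounded, in the sense that there is $y_0\in Y$ for which $\Omega:=\max_{v\in Y}W(y_0,v)$ is finite. Smoothing. For $\rho>0$, $h_\rho(x):=\max_{y\in Y}\langle Kx,y\rangle-J(y)-\rho W(y_0,y)$, a convex differentiable function. Known fact (Nesterov): with $M=\|K\|^2/(\rho\omega)$, $0\le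 h_\rho(x)-l_{h_\rho}(u,x)\le\frac{M}{2}\|x-u\|^2$ for all $x,u\in X$, where $l_h(u,x):=h(u)+\langle\nabla h(u),x-u\rangle$, and $\nabla h_\rho(x)=K^Ty^*(x)$ with $y^*(x)$ the maximizer. AGS (accelerated gradient sliding) algorithm (for $\min_{x\in X}f(x)+h(x)$). Choose $x_0\in X$ and set $\overline{x}_0=x_0$. For $k=1,\dots,N$: $$\underline{x}_k=(1-\gamma_k)\overline{x}_{k-1}+\gamma_kx_{k-1},\quad g_k(\cdot)=l_f(\underline{x}_k,\cdot),$$ $$(x_k,\tilde x_k)=\mathrm{ProxAG}(g_k,\overline{x}_{k-1},x_{k-1},\lambda_k,\beta_k,T_k),\quad \overline{x}_k=(1-\lambda_k)\overline{x}_{k-1}+\lambda_k\tilde x_k.$$ Output $\overline{x}_N$. Procedure $(x^+,\tilde x^+)=\mathrm{ProxAG}(g,\overline{x},x,\lambda,\beta,T)$: set $\tilde u_0=\overline{x}$, $u_0=x$. For $t=1,\dots,T$: $$\underline{u}_t=(1-\lambda)\overline{x}+\lambda(1-\alpha_t)\tilde u_{t-1}+\lambda\alpha_tu_{t-1},$$ $$u_t=\operatorname*{argmin}_{u\in X}\ g(u)+l_h(\underline{u}_t,u)+\beta V(x,u)+(\beta p_t+q_t)V(u_{t-1},u),$$ $$\tilde u_t=(1-\alpha_t)\tilde u_{t-1}+\alpha_tu_t.$$ Output $x^+=u_T$, $\tilde x^+=\tilde u_T$. AGS parameters used. In the first call to ProxAG ($k=1$): $\alpha_t=\frac{2}{t+1}$,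 $p_t=\frac{t-1}{2}$, $q_t=\frac{7LT_1(T_1+1)}{4\nu t}$. In the $k$-th call, $k>1$: $p_t\equiv p:=\sqrt{M/L}$, $\alpha_t\equiv\alpha:=\frac1{p+1}$, $q_t\equiv0$. Moreover $\gamma_k=\frac{2}{k+1}$; $T_1=\lceil\sqrt{8M/(7L)}\rceil$ and $T_k=\lceil\ln 3/(-\ln(1-\alpha))\rceil$ for $k>1$; $\lambda_1=1$ and $\lambda_k=\gamma_k/(1-(1-\alpha)^{T_k})$ for $k>1$; $\beta_1=L/\nu$ and $\beta_k=\frac{9L\gamma_k}{2\nu k\lambda_k}$ for $k>1$. Counting. Each outer iteration uses one evaluation of $\nabla f$; each inner iteration uses one evaluation of $\nabla h_\rho$ (and none of $\nabla f$), which costs two linear operator evaluations: one of $K$ and one of $K^T$.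
   Formalization: The number of gradient evaluations of ∇f is bounded by N_f rounded up to an integer, and the bound N_K on operator evaluations is not claimed when N_f < 1 and one outer iteration is used; without this the claim fails, e.g. X=[0,1], f=10x, L=10^-6, K=1, Y=[-1,1], J=0, ε=1, x_0=1. *)

theory Defs
  imports "HOL-Analysis.Analysis"
begin

text \<open>The ambient spaces are Euclidean spaces, whose inner product is the pairing of the problem; the
  norms that measure distances are arbitrary and unrelated to the inner product.\<close>

definition is_norm :: "('a::real_vector \<Rightarrow> real) \<Rightarrow> bool" where
  "is_norm nrm \<longleftrightarrow>
     (\<forall>x. nrm x = 0 \<longleftrightarrow> x = 0) \<and>
     (\<forall>c x. nrm (c *\<^sub>R x) = \<bar>c\<bar> * nrm x) \<and>
     (\<forall>x y. nrm (x + y) \<le> nrm x + nrm y)"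

definition op_norm ::
    "('a \<Rightarrow> real) \<Rightarrow> ('b \<Rightarrow> real) \<Rightarrow> ('a::euclidean_space \<Rightarrow> 'b::euclidean_space) \<Rightarrow> real" where
  "op_norm normX normY K = Sup {K x \<bullet> y | x y. normX x \<le> 1 \<and> normY y \<le> 1}"

definition strongly_convex_on ::
    "('a::real_vector \<Rightarrow> real) \<Rightarrow> real \<Rightarrow> 'a set \<Rightarrow> ('a \<Rightarrow> real) \<Rightarrow> bool" where
  "strongly_convex_on nrm \<sigma> Z \<pi> \<longleftrightarrow>
     (\<forall>x\<in>Z. \<forall>y\<in>Z. \<forall>t\<in>{0..1}.
        \<pi> (t *\<^sub>R x + (1 - t) *\<^sub>R y)
          \<le> t * \<pi> x + (1 - t) * \<pi> y - \<sigma> / 2 * t * (1 - t) * (nrm (x - y))\<^sup>2)"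

text \<open>A gradient relative to \<open>Z\<close>; it is not determined by the function if \<open>Z\<close> has empty interior.\<close>

definition has_gradient_on ::
    "('a::euclidean_space \<Rightarrow> real) \<Rightarrow> ('a \<Rightarrow> 'a) \<Rightarrow> 'a set \<Rightarrow> bool" where
  "has_gradient_on f G Z \<longleftrightarrow> (\<forall>z\<in>Z. (f has_derivative (\<lambda>d. G z \<bullet> d)) (at z within Z))"

definition gradient :: "('a::euclidean_space \<Rightarrow> real) \<Rightarrow> 'a \<Rightarrow> 'a" where
  "gradient h x = (THE D. GDERIV h x :> D)"

definition linearization ::
    "('a::euclidean_space \<Rightarrow> real) \<Rightarrow> ('a \<Rightarrow> 'a) \<Rightarrow> 'a \<Rightarrow> 'a \<Rightarrow> real" where
  "linearization f G u x = f u + G u \<bullet> (x - u)"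

definition prox_function ::
    "('a::euclidean_space \<Rightarrow> real) \<Rightarrow> 'a set \<Rightarrow> real \<Rightarrow> ('a \<Rightarrow> 'a \<Rightarrow> real) \<Rightarrow> bool" where
  "prox_function nrm Z \<sigma> D \<longleftrightarrow>
     (\<exists>\<pi> G. has_gradient_on \<pi> G Z \<and> strongly_convex_on nrm \<sigma> Z \<pi> \<and>
        (\<forall>z\<in>Z. \<forall>u\<in>Z. D z u = \<pi> u - \<pi> z - G z \<bullet> (u - z)))"

text \<open>Minima and maxima that only enter through their value are written as infima and suprema.\<close>

definition saddle_objective ::
    "('a \<Rightarrow> real) \<Rightarrow> ('a::euclidean_space \<Rightarrow> 'b::euclidean_space) \<Rightarrow> ('b \<Rightarrow> real) \<Rightarrow> 'b set \<Rightarrow> 'a \<Rightarrow> real" where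
  "saddle_objective f K J Y x = f x + (SUP y\<in>Y. K x \<bullet> y - J y)"

definition smoothed_max ::
    "('a::euclidean_space \<Rightarrow> 'b::euclidean_space) \<Rightarrow> ('b \<Rightarrow> real) \<Rightarrow> 'b set \<Rightarrow>
     ('b \<Rightarrow> 'b \<Rightarrow> real) \<Rightarrow> 'b \<Rightarrow> real \<Rightarrow> 'a \<Rightarrow> real" where
  "smoothed_max K J Y W y0 \<rho> x = (SUP y\<in>Y. K x \<bullet> y - J y - \<rho> * W y0 y)"

definition is_minimizer :: "('a \<Rightarrow> real) \<Rightarrow> 'a set \<Rightarrow> 'a \<Rightarrow> bool" where
  "is_minimizer \<psi> X x \<longleftrightarrow> x \<in> X \<and> (\<forall>z\<in>X. \<psi> x \<le> \<psi> z)"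

definition eps_solution :: "('a \<Rightarrow> real) \<Rightarrow> 'a set \<Rightarrow> real \<Rightarrow> 'a \<Rightarrow> bool" where
  "eps_solution \<psi> X \<epsilon> x \<longleftrightarrow> x \<in> X \<and> \<psi> x - (INF z\<in>X. \<psi> z) \<le> \<epsilon>"

text \<open>\<open>prox_ag X V h g xb x lam \<beta> \<alpha> p q t\<close> is the pair of \<open>u\<^sub>t\<close> and its running average after \<open>t\<close> inner
  steps.\<close>

primrec prox_ag ::
    "'a::euclidean_space set \<Rightarrow> ('a \<Rightarrow> 'a \<Rightarrow> real) \<Rightarrow> ('a \<Rightarrow> real) \<Rightarrow> ('a \<Rightarrow> real) \<Rightarrow> 'a \<Rightarrow> 'a \<Rightarrow>
     real \<Rightarrow> real \<Rightarrow> (nat \<Rightarrow> real) \<Rightarrow> (nat \<Rightarrow> real) \<Rightarrow> (nat \<Rightarrow> real) \<Rightarrow> nat \<Rightarrow> 'a \<times> 'a" where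
  "prox_ag X V h g xb x lam \<beta> \<alpha> p q 0 = (x, xb)"
| "prox_ag X V h g xb x lam \<beta> \<alpha> p q (Suc t) =
     (let (u, ut) = prox_ag X V h g xb x lam \<beta> \<alpha> p q t;
          a = \<alpha> (Suc t);
          um = (1 - lam) *\<^sub>R xb + (lam * (1 - a)) *\<^sub>R ut + (lam * a) *\<^sub>R u;
          u' = arg_min_on (\<lambda>v. g v + linearization h (gradient h) um v + \<beta> * V x v
                              + (\<beta> * p (Suc t) + q (Suc t)) * V u v) X
      in (u', (1 - a) *\<^sub>R ut + a *\<^sub>R u'))"

text \<open>\<open>ags X V f Gf h x0 \<gamma> lam \<beta> T \<alpha> p q k\<close> is the pair of the \<open>k\<close>-th prox centre and the \<open>k\<close>-th output
  iterate; the inner parameter sequences \<open>\<alpha> k\<close>, \<open>p k\<close>, \<open>q k\<close> depend on the outer iteration.\<close>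

primrec ags ::
    "'a::euclidean_space set \<Rightarrow> ('a \<Rightarrow> 'a \<Rightarrow> real) \<Rightarrow> ('a \<Rightarrow> real) \<Rightarrow> ('a \<Rightarrow> 'a) \<Rightarrow> ('a \<Rightarrow> real) \<Rightarrow> 'a \<Rightarrow>
     (nat \<Rightarrow> real) \<Rightarrow> (nat \<Rightarrow> real) \<Rightarrow> (nat \<Rightarrow> real) \<Rightarrow> (nat \<Rightarrow> nat) \<Rightarrow>
     (nat \<Rightarrow> nat \<Rightarrow> real) \<Rightarrow> (nat \<Rightarrow> nat \<Rightarrow> real) \<Rightarrow> (nat \<Rightarrow> nat \<Rightarrow> real) \<Rightarrow> nat \<Rightarrow> 'a \<times> 'a" where
  "ags X V f Gf h x0 \<gamma> lam \<beta> T \<alpha> p q 0 = (x0, x0)"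
| "ags X V f Gf h x0 \<gamma> lam \<beta> T \<alpha> p q (Suc k) =
     (let (x, xb) = ags X V f Gf h x0 \<gamma> lam \<beta> T \<alpha> p q k;
          j = Suc k;
          xm = (1 - \<gamma> j) *\<^sub>R xb + \<gamma> j *\<^sub>R x;
          (x', xt) = prox_ag X V h (linearization f Gf xm) xb x (lam j) (\<beta> j) (\<alpha> j) (p j) (q j) (T j)
      in (x', (1 - lam j) *\<^sub>R xb + lam j *\<^sub>R xt))"

definition ags_p :: "real \<Rightarrow> real \<Rightarrow> nat \<Rightarrow> nat \<Rightarrow> real" where
  "ags_p L M k t = (if k = 1 then (real t - 1) / 2 else sqrt (M / L))"

definition ags_\<alpha> :: "real \<Rightarrow> real \<Rightarrow> nat \<Rightarrow> nat \<Rightarrow> real" where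
  "ags_\<alpha> L M k t = (if k = 1 then 2 / (real t + 1) else 1 / (sqrt (M / L) + 1))"

definition ags_T :: "real \<Rightarrow> real \<Rightarrow> nat \<Rightarrow> nat" where
  "ags_T L M k =
     (if k = 1 then nat \<lceil>sqrt (8 * M / (7 * L))\<rceil>
      else nat \<lceil>ln 3 / - ln (1 - 1 / (sqrt (M / L) + 1))\<rceil>)"

definition ags_q :: "real \<Rightarrow> real \<Rightarrow> real \<Rightarrow> nat \<Rightarrow> nat \<Rightarrow> real" where
  "ags_q L M \<nu> k t =
     (if k = 1 then 7 * L * real (ags_T L M 1) * (real (ags_T L M 1) + 1) / (4 * \<nu> * real t) else 0)"

definition ags_\<gamma> :: "nat \<Rightarrow> real" where
  "ags_\<gamma> k = 2 / (real k + 1)"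

definition ags_lam :: "real \<Rightarrow> real \<Rightarrow> nat \<Rightarrow> real" where
  "ags_lam L M k =
     (if k = 1 then 1
      else ags_\<gamma> k / (1 - (1 - 1 / (sqrt (M / L) + 1)) ^ ags_T L M k))"

definition ags_\<beta> :: "real \<Rightarrow> real \<Rightarrow> real \<Rightarrow> nat \<Rightarrow> real" where
  "ags_\<beta> L M \<nu> k =
     (if k = 1 then L / \<nu> else 9 * L * ags_\<gamma> k / (2 * \<nu> * real k * ags_lam L M k))"

definition ags_output ::
    "'a::euclidean_space set \<Rightarrow> ('a \<Rightarrow> 'a \<Rightarrow> real) \<Rightarrow> ('a \<Rightarrow> real) \<Rightarrow> ('a \<Rightarrow> 'a) \<Rightarrow> ('a \<Rightarrow> real) \<Rightarrow>
     real \<Rightarrow> real \<Rightarrow> real \<Rightarrow> 'a \<Rightarrow> nat \<Rightarrow> 'a" where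
  "ags_output X V f Gf h L M \<nu> x0 N =
     snd (ags X V f Gf h x0 ags_\<gamma> (ags_lam L M) (ags_\<beta> L M \<nu>) (ags_T L M)
            (ags_\<alpha> L M) (ags_p L M) (ags_q L M \<nu>) N)"

text \<open>Evaluations made by the first \<open>N\<close> outer iterations: each evaluates the gradient of \<open>f\<close> once, and
  each of its inner steps evaluates the gradient of \<open>h\<close> once, at the cost of one application of \<open>K\<close>
  and one of its transpose.\<close>

definition f_evals :: "nat \<Rightarrow> nat" where
  "f_evals N = (\<Sum>k=1..N. 1)"

definition op_evals :: "(nat \<Rightarrow> nat) \<Rightarrow> nat \<Rightarrow> nat" where
  "op_evals T N = (\<Sum>k=1..N. \<Sum>t=1..T k. 2)"

end

theory Submission
  imports Defs
begin

text \<open>Subtracting \<open>\<rho> W y0\<close> makes the inner maximisation strongly concave, so \<open>h\<close> is the composition of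
  \<open>K\<close> with the conjugate of a strongly convex function, which makes it smooth with constant \<open>M\<close>; the choice of
  \<open>\<rho>\<close> bounds the smoothing error by \<open>\<epsilon>/2\<close>. Within one outer iteration, the three-point inequality of the
  prox step and the smoothness of \<open>h\<close> give a telescoping recursion, and the parameters are such that
  \<open>k (k + 1) (\<psi> (xbar k) - \<psi> v) + 9 L / \<nu> * V (x k) v\<close> does not increase with \<open>k\<close>, where \<open>\<psi> = f + h\<close>. Thus
  the \<open>N\<close>-th output has a smoothed gap of at most \<open>9 L V / (\<nu> N (N + 1))\<close>. Put
  \<open>s\<^sup>2 = 2 L V / (\<nu> \<epsilon>)\<close>. The output is accurate once \<open>N (N + 1) \<ge> 9 s\<^sup>2\<close>. Since \<open>M \<ge> L\<close>, every
  inner loop has at most \<open>1.64 (sqrt (M / L) + 1)\<close> steps, which turns the least such \<open>N\<close> into the bound on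
  operator evaluations.\<close>

section \<open>Norms\<close>

lemma is_norm_0: "is_norm nrm \<Longrightarrow> nrm 0 = 0"
  by (simp add: is_norm_def)

lemma is_norm_scale: "is_norm nrm \<Longrightarrow> nrm (c *\<^sub>R x) = \<bar>c\<bar> * nrm x"
  by (simp add: is_norm_def)

lemma is_norm_triangle: "is_norm nrm \<Longrightarrow> nrm (x + y) \<le> nrm x + nrm y"
  by (simp add: is_norm_def)

lemma is_norm_minus: "is_norm nrm \<Longrightarrow> nrm (- x) = nrm x"
  using is_norm_scale[of nrm "-1" x] by simp

lemma is_norm_minus_commute: "is_norm nrm \<Longrightarrow> nrm (x - y) = nrm (y - x)"
  using is_norm_minus[of nrm "x - y"] by simp

lemma is_norm_nonneg: "is_norm nrm \<Longrightarrow> 0 \<le> nrm x"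
  using is_norm_triangle[of nrm x "- x"] by (simp add: is_norm_minus is_norm_0)

text \<open>Expansion in the standard basis, together with the triangle inequality, leaves only the
  values of the norm on the basis vectors. The summand 1 in the constant makes it positive at
  once.\<close>

lemma is_norm_le_norm:
  fixes nrm :: "'a::euclidean_space \<Rightarrow> real"
  assumes "is_norm nrm"
  obtains C where "C > 0" "\<And>x. nrm x \<le> C * norm x"
proof
  have tri: "nrm (\<Sum>i\<in>A. g i) \<le> (\<Sum>i\<in>A. nrm (g i))" if "finite A" for A and g :: "'a \<Rightarrow> 'a"
    using that
  proof (induction A rule: finite_induct)
    case (insert a A)
    then show ?case
      using is_norm_triangle[OF assms, of "g a" "\<Sum>i\<in>A. g i"] by simp
  qed (simp add: is_norm_0[OF assms])
  let ?C = "(\<Sum>b\<in>Basis. nrm b) + 1"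
  show "?C > 0"
    using sum_nonneg[of Basis nrm] is_norm_nonneg[OF assms] by (smt (verit))
  fix x :: 'a
  have "nrm x = nrm (\<Sum>b\<in>Basis. (x \<bullet> b) *\<^sub>R b)"
    by (simp add: euclidean_representation)
  also have "\<dots> \<le> (\<Sum>b\<in>Basis. nrm ((x \<bullet> b) *\<^sub>R b))"
    by (rule tri) simp
  also have "\<dots> \<le> (\<Sum>b\<in>Basis. norm x * nrm b)"
    by (intro sum_mono) (auto simp: is_norm_scale[OF assms] is_norm_nonneg[OF assms]
        Basis_le_norm intro!: mult_right_mono)
  also have "\<dots> \<le> ?C * norm x"
    by (simp add: sum_distrib_left[symmetric] algebra_simps)
  finally show "nrm x \<le> ?C * norm x" .
qed

lemma is_norm_continuous:
  fixes nrm :: "'a::euclidean_space \<Rightarrow> real"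
  assumes "is_norm nrm"
  shows "continuous_on S nrm"
proof -
  obtain C where C: "C > 0" "\<And>x. nrm x \<le> C * norm x"
    using is_norm_le_norm[OF assms] by blast
  have "dist (nrm x) (nrm y) \<le> C * dist x y" for x y
  proof -
    have "nrm x \<le> nrm (x - y) + nrm y" "nrm y \<le> nrm (x - y) + nrm x"
      using is_norm_triangle[OF assms, of "x - y" y] is_norm_triangle[OF assms, of "y - x" x]
      by (simp_all add: is_norm_minus_commute[OF assms, of y x])
    with C(2)[of "x - y"] show ?thesis
      by (simp add: dist_norm)
  qed
  then have "C-lipschitz_on S nrm"
    using C(1) by (intro lipschitz_onI) auto
  then show ?thesis
    by (rule lipschitz_on_continuous_on)
qed

text \<open>The constant is the minimum of the norm over the Euclidean unit sphere, attained by
  compactness and nonzero because 0 is not on the sphere; homogeneity does the rest.\<close>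

lemma norm_le_is_norm:
  fixes nrm :: "'a::euclidean_space \<Rightarrow> real"
  assumes "is_norm nrm"
  obtains c where "c > 0" "\<And>x. c * norm x \<le> nrm x"
proof -
  have "sphere (0::'a) 1 \<noteq> {}"
    by simp
  then obtain z :: 'a where z: "z \<in> sphere 0 1" "\<And>x. x \<in> sphere 0 1 \<Longrightarrow> nrm z \<le> nrm x"
    using continuous_attains_inf[OF compact_sphere _ is_norm_continuous[OF assms]] by metis
  have "nrm z \<noteq> 0"
    using z(1) assms by (auto simp: is_norm_def)
  with is_norm_nonneg[OF assms, of z] have "nrm z > 0"
    by simp
  moreover have "nrm z * norm x \<le> nrm x" for x
  proof (cases "x = 0")
    case False
    then have "nrm z \<le> nrm ((1 / norm x) *\<^sub>R x)"
      by (intro z) simp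
    with False show ?thesis
      by (simp add: is_norm_scale[OF assms] field_simps)
  qed (simp add: is_norm_0[OF assms])
  ultimately show ?thesis
    by (rule that)
qed

text \<open>\<open>Sup\<close> says something only about a bounded set. Both norms dominate
  multiples of the Euclidean one, so the defining set is bounded; it contains 0, and normalising
  \<open>x\<close> and \<open>y\<close> gives the product bound.\<close>

lemma op_norm_bound:
  fixes K :: "'a::euclidean_space \<Rightarrow> 'b::euclidean_space"
  assumes nX: "is_norm normX" and nY: "is_norm normY" and K: "linear K"
  shows "0 \<le> op_norm normX normY K" and "K x \<bullet> y \<le> op_norm normX normY K * normX x * normY y"
proof -
  let ?S = "{K x \<bullet> y | x y. normX x \<le> 1 \<and> normY y \<le> 1}"
  obtain c where c: "c > 0" "\<And>x. c * norm x \<le> normX x"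
    using norm_le_is_norm[OF nX] by blast
  obtain d where d: "d > 0" "\<And>y. d * norm y \<le> normY y"
    using norm_le_is_norm[OF nY] by blast
  obtain B where B: "B > 0" "\<And>x. norm (K x) \<le> B * norm x"
    using linear_bounded_pos[OF K] by blast
  have "r \<le> (B * (1 / c)) * (1 / d)" if "r \<in> ?S" for r
  proof -
    from that obtain x y where xy: "r = K x \<bullet> y" "normX x \<le> 1" "normY y \<le> 1"
      by blast
    have "norm x \<le> 1 / c" "norm y \<le> 1 / d"
      using c(2)[of x] d(2)[of y] c(1) d(1) xy by (auto simp: field_simps)
    moreover from this(1) have "norm (K x) \<le> B * (1 / c)"
      using B(2)[of x] mult_left_mono[of "norm x" "1 / c" B] B(1) by linarith
    ultimately have "norm (K x) * norm y \<le> (B * (1 / c)) * (1 / d)"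
      using B(1) c(1) by (intro mult_mono) auto
    then show ?thesis
      using norm_cauchy_schwarz[of "K x" y] xy by simp
  qed
  then have bdd: "bdd_above ?S"
    by (rule bdd_aboveI)
  have "0 \<in> ?S"
    using is_norm_0[OF nX] is_norm_0[OF nY] by (intro CollectI exI[of _ 0]) simp
  then show nonneg: "0 \<le> op_norm normX normY K"
    unfolding op_norm_def using bdd by (rule cSup_upper)
  show "K x \<bullet> y \<le> op_norm normX normY K * normX x * normY y"
  proof (cases "x = 0 \<or> y = 0")
    case True
    then show ?thesis
      using is_norm_0[OF nX] is_norm_0[OF nY] linear_0[OF K] by auto
  next
    case False
    then have "normX x \<noteq> 0" "normY y \<noteq> 0"
      using nX nY by (auto simp: is_norm_def)
    then have pos: "normX x > 0" "normY y > 0"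
      using is_norm_nonneg[OF nX, of x] is_norm_nonneg[OF nY, of y] by auto
    have "K ((1 / normX x) *\<^sub>R x) \<bullet> ((1 / normY y) *\<^sub>R y) \<in> ?S"
      using pos by (intro CollectI exI[of _ "(1 / normX x) *\<^sub>R x"]
          exI[of _ "(1 / normY y) *\<^sub>R y"] conjI refl)
        (simp_all add: is_norm_scale[OF nX] is_norm_scale[OF nY])
    then have "K ((1 / normX x) *\<^sub>R x) \<bullet> ((1 / normY y) *\<^sub>R y) \<le> op_norm normX normY K"
      unfolding op_norm_def using bdd by (rule cSup_upper)
    then show ?thesis
      using pos by (simp add: linear_scale[OF K] field_simps)
  qed
qed

section \<open>Prox-functions\<close>

text \<open>A gradient relative to \<open>Z\<close> controls only increments that stay in
  \<open>Z\<close>. Convexity keeps the segment from \<open>z\<close> to \<open>w\<close> inside,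
  which yields a one-sided directional derivative, all that the optimality arguments use.\<close>

lemma gradient_direction_tendsto:
  assumes G: "has_gradient_on f G Z" and "convex Z" "z \<in> Z" "w \<in> Z"
  shows "((\<lambda>t. (f (z + t *\<^sub>R (w - z)) - f z) / t) \<longlongrightarrow> G z \<bullet> (w - z)) (at_right 0)"
proof -
  let ?l = "\<lambda>t. z + t *\<^sub>R (w - z)"
  have "z + t *\<^sub>R (w - z) = (1 - t) *\<^sub>R z + t *\<^sub>R w" for t :: real
    by (simp add: algebra_simps)
  then have im: "?l ` {0..1} \<subseteq> Z"
    using assms(2-4) by (auto intro!: convexD_alt)
  have "(f has_derivative (\<lambda>d. G z \<bullet> d)) (at (?l 0) within Z)"
    using G assms(3) by (simp add: has_gradient_on_def)
  then have "(f has_derivative (\<lambda>d. G z \<bullet> d)) (at (?l 0) within ?l ` {0..1})"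
    using im by (rule has_derivative_subset)
  moreover have "(?l has_derivative (\<lambda>t. t *\<^sub>R (w - z))) (at 0 within {0..1})"
    by (auto intro!: derivative_eq_intros)
  ultimately have "((\<lambda>t. f (?l t)) has_derivative (\<lambda>t. G z \<bullet> (t *\<^sub>R (w - z)))) (at 0 within {0..1})"
    by (rule has_derivative_in_compose[rotated])
  then have "((\<lambda>t. f (?l t)) has_field_derivative (G z \<bullet> (w - z))) (at 0 within {0..1})"
    by (simp add: has_field_derivative_def mult.commute[of _ "G z \<bullet> (w - z)"])
  then show ?thesis
    by (simp add: has_field_derivative_iff at_within_Icc_at_right)
qed

text \<open>Dividing the strong convexity inequality on the segment by \<open>t\<close> and letting
  \<open>t\<close> tend to 0 turns the difference quotient into the gradient term and the factor
  \<open>1 - t\<close> into 1.\<close>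

lemma prox_function_lower:
  assumes "prox_function nrm Z \<sigma> D" and Z: "convex Z" "z \<in> Z" "w \<in> Z" and n: "is_norm nrm"
  shows "\<sigma> / 2 * (nrm (z - w))\<^sup>2 \<le> D z w"
proof -
  obtain \<pi> G where G: "has_gradient_on \<pi> G Z" and sc: "strongly_convex_on nrm \<sigma> Z \<pi>"
    and D: "D z w = \<pi> w - \<pi> z - G z \<bullet> (w - z)"
    using assms unfolding prox_function_def by blast
  let ?n = "(nrm (z - w))\<^sup>2"
  have "((\<lambda>t. \<pi> w - \<pi> z - \<sigma> / 2 * (1 - t) * ?n) \<longlongrightarrow> \<pi> w - \<pi> z - \<sigma> / 2 * (1 - 0) * ?n) (at_right 0)"
    by (intro tendsto_intros)
  moreover have "((\<lambda>t. (\<pi> (z + t *\<^sub>R (w - z)) - \<pi> z) / t) \<longlongrightarrow> G z \<bullet> (w - z)) (at_right 0)"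
    using gradient_direction_tendsto[OF G Z] .
  moreover have "\<forall>\<^sub>F t in at_right 0. (\<pi> (z + t *\<^sub>R (w - z)) - \<pi> z) / t \<le> \<pi> w - \<pi> z - \<sigma> / 2 * (1 - t) * ?n"
    unfolding eventually_at_right_field
  proof (intro exI[of _ 1] conjI allI impI)
    fix t :: real assume t: "0 < t" "t < 1"
    have "t *\<^sub>R w + (1 - t) *\<^sub>R z = z + t *\<^sub>R (w - z)"
      by (simp add: algebra_simps)
    moreover have "\<pi> (t *\<^sub>R w + (1 - t) *\<^sub>R z) \<le> t * \<pi> w + (1 - t) * \<pi> z - \<sigma> / 2 * t * (1 - t) * (nrm (w - z))\<^sup>2"
      using sc Z t unfolding strongly_convex_on_def by simp
    ultimately have "\<pi> (z + t *\<^sub>R (w - z)) - \<pi> z \<le> t * (\<pi> w - \<pi> z - \<sigma> / 2 * (1 - t) * ?n)"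
      by (simp add: is_norm_minus_commute[OF n, of w z] algebra_simps)
    then show "(\<pi> (z + t *\<^sub>R (w - z)) - \<pi> z) / t \<le> \<pi> w - \<pi> z - \<sigma> / 2 * (1 - t) * ?n"
      using t by (simp add: field_simps)
  qed simp
  ultimately have "G z \<bullet> (w - z) \<le> \<pi> w - \<pi> z - \<sigma> / 2 * (1 - 0) * ?n"
    by (intro tendsto_le[OF trivial_limit_at_right_real])
  then show ?thesis
    by (simp add: D)
qed

lemma prox_function_nonneg:
  assumes "prox_function nrm Z \<sigma> D" "convex Z" "z \<in> Z" "w \<in> Z" "is_norm nrm" "\<sigma> > 0"
  shows "0 \<le> D z w"
  using prox_function_lower[OF assms(1-5)] assms(6)
  by (meson divide_nonneg_nonneg less_imp_le mult_nonneg_nonneg order_trans zero_le_numeral zero_le_power2)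

lemma prox_function_continuous:
  assumes "prox_function nrm Z \<sigma> D" "z \<in> Z"
  shows "continuous_on Z (D z)"
proof -
  obtain \<pi> G where G: "has_gradient_on \<pi> G Z"
    and D: "\<And>w. w \<in> Z \<Longrightarrow> D z w = \<pi> w - \<pi> z - G z \<bullet> (w - z)"
    using assms unfolding prox_function_def by blast
  have "continuous_on Z \<pi>"
    using G unfolding has_gradient_on_def
    by (auto simp: continuous_on_eq_continuous_within intro: has_derivative_continuous)
  then have "continuous_on Z (\<lambda>w. \<pi> w - \<pi> z - G z \<bullet> (w - z))"
    by (intro continuous_intros)
  then show ?thesis
    by (subst continuous_on_cong[OF refl D])
qed

lemma prox_function_strongly_convex:
  assumes "prox_function nrm Z \<sigma> D" "z \<in> Z" "convex Z"
  shows "strongly_convex_on nrm \<sigma> Z (D z)"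
  unfolding strongly_convex_on_def
proof (intro ballI)
  obtain \<pi> G where sc: "strongly_convex_on nrm \<sigma> Z \<pi>"
    and D: "\<And>w. w \<in> Z \<Longrightarrow> D z w = \<pi> w - \<pi> z - G z \<bullet> (w - z)"
    using assms unfolding prox_function_def by blast
  fix x y and t :: real assume xy: "x \<in> Z" "y \<in> Z" "t \<in> {0..1}"
  then have "t *\<^sub>R x + (1 - t) *\<^sub>R y \<in> Z"
    using assms(3) by (auto intro!: convexD)
  moreover have "\<pi> (t *\<^sub>R x + (1 - t) *\<^sub>R y)
      \<le> t * \<pi> x + (1 - t) * \<pi> y - \<sigma> / 2 * t * (1 - t) * (nrm (x - y))\<^sup>2"
    using sc xy unfolding strongly_convex_on_def by blast
  ultimately show "D z (t *\<^sub>R x + (1 - t) *\<^sub>R y)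
      \<le> t * D z x + (1 - t) * D z y - \<sigma> / 2 * t * (1 - t) * (nrm (x - y))\<^sup>2"
    using xy by (simp add: D inner_diff_right inner_add_right) (simp add: algebra_simps)
qed

text \<open>\<open>arg_min_on\<close> is informative only once a minimiser exists. The term with
  \<open>c > 0\<close> grows quadratically and beats the affine part, so the search can be confined
  to a ball, where compactness applies.\<close>

lemma prox_step_minimizer:
  fixes X :: "'a::euclidean_space set"
  assumes n: "is_norm nrm" and X: "closed X" "convex X" and V: "prox_function nrm X \<nu> V" and "\<nu> > 0"
    and l: "\<And>v. l v = b + a \<bullet> v" and x: "x \<in> X" and u: "u \<in> X" and c: "c > 0" "d \<ge> 0"
  defines "w \<equiv> arg_min_on (\<lambda>v. l v + c * V x v + d * V u v) X"
  shows "w \<in> X" and "\<And>v. v \<in> X \<Longrightarrow> l w + c * V x w + d * V u w \<le> l v + c * V x v + d * V u v"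
proof -
  let ?F = "\<lambda>v. l v + c * V x v + d * V u v"
  obtain m where m: "m > 0" "\<And>x. m * norm x \<le> nrm x"
    using norm_le_is_norm[OF n] by blast
  define k where "k = c * (\<nu> / 2) * m\<^sup>2"
  have k: "k > 0"
    unfolding k_def using c m \<open>\<nu> > 0\<close> by simp
  have low: "l x - norm a * norm (v - x) + k * (norm (v - x))\<^sup>2 \<le> ?F v" if "v \<in> X" for v
  proof -
    have "(m * norm (v - x))\<^sup>2 \<le> (nrm (x - v))\<^sup>2"
      using m(2)[of "v - x"] m(1) by (intro power_mono) (auto simp: is_norm_minus_commute[OF n, of x v])
    then have "\<nu> / 2 * (m * norm (v - x))\<^sup>2 \<le> \<nu> / 2 * (nrm (x - v))\<^sup>2"
      using \<open>\<nu> > 0\<close> by simp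
    also have "\<dots> \<le> V x v"
      by (rule prox_function_lower[OF V X(2) x that n])
    finally have "c * (\<nu> / 2 * (m * norm (v - x))\<^sup>2) \<le> c * V x v"
      using c by simp
    moreover have "0 \<le> d * V u v"
      using c prox_function_nonneg[OF V X(2) u that n \<open>\<nu> > 0\<close>] by simp
    moreover have "l x - norm a * norm (v - x) \<le> l v"
      using Cauchy_Schwarz_ineq2[of a "v - x"] by (simp add: l inner_diff_right)
    ultimately show ?thesis
      by (simp add: k_def power_mult_distrib algebra_simps)
  qed
  \<comment> \<open>Beyond this radius \<open>k\<close> times the squared distance outweighs both
    the linear loss and the gap \<open>?F x - l x\<close>. The added 1 lets a constant be bounded by
    its multiple with the distance.\<close>
  define r where "r = (norm a + \<bar>?F x - l x\<bar>) / k + 1"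
  have r: "r \<ge> 1"
    using k by (simp add: r_def)
  have far: "?F x < ?F v" if "v \<in> X" "norm (v - x) > r" for v
  proof -
    let ?s = "norm (v - x)"
    have "?s \<ge> 1"
      using that r by simp
    have "norm a + \<bar>?F x - l x\<bar> < k * ?s"
    proof -
      have "norm a + \<bar>?F x - l x\<bar> = k * (r - 1)"
        using k by (simp add: r_def)
      also have "\<dots> < k * ?s"
        using k that by (intro mult_strict_left_mono) auto
      finally show ?thesis .
    qed
    then have "(norm a + \<bar>?F x - l x\<bar>) * ?s < k * ?s * ?s"
      using \<open>?s \<ge> 1\<close> by (intro mult_strict_right_mono) auto
    moreover have "\<bar>?F x - l x\<bar> \<le> \<bar>?F x - l x\<bar> * ?s"
      using \<open>?s \<ge> 1\<close> by (simp add: mult_le_cancel_left1)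
    ultimately have "\<bar>?F x - l x\<bar> < k * ?s\<^sup>2 - norm a * ?s"
      by (simp add: distrib_right power2_eq_square mult.assoc)
    with low[OF that(1)] show ?thesis
      by linarith
  qed
  have cont: "continuous_on X ?F"
    by (simp only: l) (intro continuous_intros prox_function_continuous[OF V] x u)
  have "compact (X \<inter> cball x r)"
    using X by (simp add: closed_Int_compact)
  moreover have "x \<in> X \<inter> cball x r"
    using x r by simp
  ultimately obtain z where z: "z \<in> X \<inter> cball x r" "\<And>v. v \<in> X \<inter> cball x r \<Longrightarrow> ?F z \<le> ?F v"
    using continuous_attains_inf[of "X \<inter> cball x r" ?F] continuous_on_subset[OF cont] by blast
  have "?F z \<le> ?F v" if "v \<in> X" for v
  proof (cases "norm (v - x) \<le> r")
    case True
    then show ?thesis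
      using z(2)[of v] that by (simp add: dist_norm norm_minus_commute)
  next
    case False
    then have "?F x < ?F v"
      using far that by simp
    then show ?thesis
      using z(2)[of x] \<open>x \<in> X \<inter> cball x r\<close> by linarith
  qed
  then have "is_arg_min ?F (\<lambda>v. v \<in> X) z"
    using z(1) by (auto simp: is_arg_min_linorder)
  then have "is_arg_min ?F (\<lambda>v. v \<in> X) w"
    unfolding w_def arg_min_on_def arg_min_def by (rule someI)
  then show "w \<in> X" and "\<And>v. v \<in> X \<Longrightarrow> ?F w \<le> ?F v"
    by (auto simp: is_arg_min_linorder)
qed

text \<open>First-order optimality at \<open>w\<close> in the direction of \<open>v\<close>,
  rewritten in Bregman distances. The term \<open>(c + d) * V w v\<close> is exactly the gap between
  the objective and its first-order expansion at \<open>w\<close>.\<close>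

lemma prox_step_three_point:
  fixes X :: "'a::euclidean_space set"
  assumes n: "is_norm nrm" and X: "closed X" "convex X" and V: "prox_function nrm X \<nu> V" and "\<nu> > 0"
    and l: "\<And>v. l v = b + a \<bullet> v" and x: "x \<in> X" and u: "u \<in> X" and c: "c > 0" "d \<ge> 0"
    and v: "v \<in> X"
  defines "w \<equiv> arg_min_on (\<lambda>v. l v + c * V x v + d * V u v) X"
  shows "l w + c * V x w + d * V u w + (c + d) * V w v \<le> l v + c * V x v + d * V u v"
proof -
  let ?F = "\<lambda>v. l v + c * V x v + d * V u v"
  note min = prox_step_minimizer[OF n X V \<open>\<nu> > 0\<close> l x u c, folded w_def]
  obtain \<pi> G where G: "has_gradient_on \<pi> G X"
    and D: "\<And>z w. z \<in> X \<Longrightarrow> w \<in> X \<Longrightarrow> V z w = \<pi> w - \<pi> z - G z \<bullet> (w - z)"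
    using V unfolding prox_function_def by blast
  \<comment> \<open>The slope of the affine part: up to it the objective is \<open>(c + d)\<close>
    times \<pi>, since the centres \<open>x\<close> and \<open>u\<close> enter the prox terms only
    affinely.\<close>
  let ?a = "a - c *\<^sub>R G x - d *\<^sub>R G u"
  have "((\<lambda>t. ?a \<bullet> (v - w) + (c + d) * ((\<pi> (w + t *\<^sub>R (v - w)) - \<pi> w) / t))
      \<longlongrightarrow> ?a \<bullet> (v - w) + (c + d) * (G w \<bullet> (v - w))) (at_right 0)"
    by (intro tendsto_intros gradient_direction_tendsto[OF G X(2) min(1) v])
  moreover have "\<forall>\<^sub>F t in at_right 0. 0 \<le> ?a \<bullet> (v - w) + (c + d) * ((\<pi> (w + t *\<^sub>R (v - w)) - \<pi> w) / t)"
    unfolding eventually_at_right_field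
  proof (intro exI[of _ 1] conjI allI impI)
    fix t :: real assume t: "0 < t" "t < 1"
    let ?y = "w + t *\<^sub>R (v - w)"
    have "(1 - t) *\<^sub>R w + t *\<^sub>R v = ?y"
      by (simp add: algebra_simps)
    then have y: "?y \<in> X"
      using convexD_alt[OF X(2) min(1) v, of t] t by simp
    have "?F w \<le> ?F ?y"
      by (rule min(2)[OF y])
    then have "0 \<le> t * (?a \<bullet> (v - w)) + (c + d) * (\<pi> ?y - \<pi> w)"
      using x u y min(1) by (simp add: D l inner_diff_left inner_diff_right inner_add_right algebra_simps)
    then show "0 \<le> ?a \<bullet> (v - w) + (c + d) * ((\<pi> ?y - \<pi> w) / t)"
      using t by (simp add: field_simps)
  qed simp
  ultimately have "0 \<le> ?a \<bullet> (v - w) + (c + d) * (G w \<bullet> (v - w))"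
    by (intro tendsto_lowerbound[OF _ _ trivial_limit_at_right_real])
  then show ?thesis
    using x u v min(1) by (simp add: D l inner_diff_left inner_diff_right algebra_simps)
qed

section \<open>Conjugates of strongly convex functions\<close>

text \<open>No semicontinuity of \<open>J\<close> is available. Instead \<open>J\<close> is bounded
  above on a simplex by its vertices, and reflecting \<open>y\<close> through a relatively interior
  point \<open>z\<close> of the simplex makes \<open>z\<close> a convex combination of
  \<open>y\<close> and a point of the simplex, so that \<open>J y\<close> cannot be too
  small.\<close>

lemma convex_on_bounded_imp_bdd_below:
  fixes J :: "'b::euclidean_space \<Rightarrow> real"
  assumes J: "convex_on Y J" and Y: "bounded Y" "y0 \<in> Y"
  obtains c where "\<And>y. y \<in> Y \<Longrightarrow> c \<le> J y"
proof -
  have cY: "convex Y"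
    using J by (simp add: convex_on_def)
  obtain B where B: "\<not> affine_dependent B" "B \<subseteq> Y" "affine hull B = affine hull Y"
    using affine_basis_exists by blast
  have fin: "finite B"
    using B(1) aff_independent_finite by blast
  have "B \<noteq> {}"
    using B(3) Y(2) by (metis affine_hull_eq_empty empty_iff)
  have sub: "convex hull B \<subseteq> Y"
    using B(2) cY by (simp add: hull_minimal)
  have up: "J y \<le> Max (J ` B)" if "y \<in> convex hull B" for y
    using convex_on_convex_hull_bound[of B J "Max (J ` B)"] convex_on_subset[OF J sub] fin that
      convex_convex_hull[of B] by auto
  have "rel_interior (convex hull B) \<noteq> {}"
    using \<open>B \<noteq> {}\<close> by (simp add: rel_interior_eq_empty)
  then obtain z e where z: "z \<in> convex hull B" and e: "e > 0" "ball z e \<inter> affine hull B \<subseteq> convex hull B"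
    by (auto simp: mem_rel_interior_ball)
  obtain D where D: "D > 0" "\<And>x. x \<in> Y \<Longrightarrow> norm x \<le> D"
    using Y(1) by (auto simp: bounded_pos)
  \<comment> \<open>Points of \<open>Y\<close> are at most \<open>2 * D\<close> apart, so the
    reflected point lies within \<open>e / 2\<close> of \<open>z\<close>.\<close>
  define s where "s = e / (4 * D)"
  have s: "s > 0"
    using e D by (simp add: s_def)
  show thesis
  proof
    fix y assume y: "y \<in> Y"
    let ?y' = "z + s *\<^sub>R (z - y)"
    have zY: "z \<in> Y"
      using z sub by blast
    have "norm (z - y) \<le> 2 * D"
      using D(2)[OF y] D(2)[OF zY] norm_triangle_ineq4[of z y] by linarith
    then have "s * norm (z - y) \<le> s * (2 * D)"
      using s by simp
    also have "\<dots> < e"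
      using D(1) e(1) by (simp add: s_def)
    finally have "?y' \<in> ball z e"
      using s by (simp add: dist_norm)
    moreover have "?y' \<in> affine hull Y"
    proof -
      have "(1 + s) *\<^sub>R z + (- s) *\<^sub>R y \<in> affine hull Y"
        using y zY by (intro mem_affine[OF affine_affine_hull]) (auto intro: hull_inc)
      moreover have "(1 + s) *\<^sub>R z + (- s) *\<^sub>R y = ?y'"
        by (simp add: algebra_simps)
      ultimately show ?thesis
        by simp
    qed
    ultimately have y': "?y' \<in> convex hull B"
      using e(2) B(3) by blast
    have "z = (1 - s / (1 + s)) *\<^sub>R ?y' + (s / (1 + s)) *\<^sub>R y"
    proof -
      have *: "1 - s / (1 + s) = 1 / (1 + s)"
        using s by (simp add: field_simps)
      have "(1 + s) *\<^sub>R ((1 - s / (1 + s)) *\<^sub>R ?y' + (s / (1 + s)) *\<^sub>R y) = (1 + s) *\<^sub>R z"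
        unfolding * using s by (simp add: scaleR_add_right) (simp add: algebra_simps)
      then show ?thesis
        using s by simp
    qed
    moreover have "J ((1 - s / (1 + s)) *\<^sub>R ?y' + (s / (1 + s)) *\<^sub>R y)
        \<le> (1 - s / (1 + s)) * J ?y' + (s / (1 + s)) * J y"
      using y y' sub s by (intro convex_onD[OF J]) (auto simp: field_simps)
    ultimately have "J z \<le> (1 - s / (1 + s)) * J ?y' + (s / (1 + s)) * J y"
      by simp
    also have "\<dots> = (J ?y' + s * J y) / (1 + s)"
      using s by (simp add: divide_simps)
    finally have "(1 + s) * J z \<le> J ?y' + s * J y"
      using s by (simp only: pos_le_divide_eq mult.commute)
    with up[OF y'] s show "((1 + s) * J z - Max (J ` B)) / s \<le> J y"
      by (simp add: field_simps)
  qed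
qed

text \<open>The supremum need not be attained, since the concave function is not assumed to be upper
  semicontinuous; the limit of a maximising sequence takes the place of the maximiser.\<close>

lemma strongly_concave_sup:
  fixes F :: "'b::euclidean_space \<Rightarrow> real"
  assumes n: "is_norm nrm" and Y: "closed Y" "convex Y" "Y \<noteq> {}" and \<sigma>: "\<sigma> > 0"
    and bdd: "bdd_above (F ` Y)" and sc: "strongly_convex_on nrm \<sigma> Y (\<lambda>y. - F y)"
  obtains ys z where "\<And>i. ys i \<in> Y" "ys \<longlonglongrightarrow> z" "(\<lambda>i. F (ys i)) \<longlonglongrightarrow> (SUP y\<in>Y. F y)"
    "\<And>y. y \<in> Y \<Longrightarrow> F y + \<sigma> / 2 * (nrm (y - z))\<^sup>2 \<le> (SUP y\<in>Y. F y)"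
proof -
  let ?S = "SUP y\<in>Y. F y"
  have up: "F y \<le> ?S" if "y \<in> Y" for y
    using that bdd by (rule cSUP_upper)
  have "\<exists>y\<in>Y. ?S - 1 / real (Suc i) < F y" for i
    using less_cSUP_iff[OF Y(3) bdd, of "?S - 1 / real (Suc i)"] by simp
  then obtain ys where ys: "\<And>i. ys i \<in> Y" "\<And>i. ?S - 1 / real (Suc i) < F (ys i)"
    by metis
  have concave: "t * F x + (1 - t) * F y + \<sigma> / 2 * t * (1 - t) * (nrm (x - y))\<^sup>2 \<le> ?S"
    if "x \<in> Y" "y \<in> Y" "0 \<le> t" "t \<le> 1" for x y t
  proof -
    have "t *\<^sub>R x + (1 - t) *\<^sub>R y \<in> Y"
      using that Y(2) by (intro convexD) auto
    then have "F (t *\<^sub>R x + (1 - t) *\<^sub>R y) \<le> ?S"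
      by (rule up)
    moreover have "- F (t *\<^sub>R x + (1 - t) *\<^sub>R y)
        \<le> t * - F x + (1 - t) * - F y - \<sigma> / 2 * t * (1 - t) * (nrm (x - y))\<^sup>2"
      using sc that unfolding strongly_convex_on_def by (meson atLeastAtMost_iff)
    ultimately show ?thesis
      by (simp only: mult_minus_right)
  qed
  have lim0: "(\<lambda>i. 1 / real (Suc i)) \<longlonglongrightarrow> 0"
    using LIMSEQ_inverse_real_of_nat by (simp add: inverse_eq_divide)
  have lim: "(\<lambda>i. F (ys i)) \<longlonglongrightarrow> ?S"
  proof (rule tendsto_sandwich[OF _ _ _ tendsto_const])
    show "(\<lambda>i. ?S - 1 / real (Suc i)) \<longlonglongrightarrow> ?S"
      using tendsto_diff[OF tendsto_const lim0, of ?S] by simp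
  qed (use ys up in \<open>auto intro!: always_eventually less_imp_le\<close>)
  obtain m where m: "m > 0" "\<And>x. m * norm x \<le> nrm x"
    using norm_le_is_norm[OF n] by blast
  have "Cauchy ys"
  proof (rule metric_CauchyI)
    fix e :: real assume "e > 0"
    then have "0 < \<sigma> / 8 * (m * e)\<^sup>2"
      using \<sigma> m by simp
    from order_tendstoD(2)[OF lim0 this] obtain N where N: "\<And>i. i \<ge> N \<Longrightarrow> 1 / real (Suc i) < \<sigma> / 8 * (m * e)\<^sup>2"
      by (auto simp: eventually_sequentially)
    have "dist (ys i) (ys j) < e" if "i \<ge> N" "j \<ge> N" for i j
    proof -
      have "\<sigma> / 8 * (nrm (ys i - ys j))\<^sup>2 < \<sigma> / 8 * (m * e)\<^sup>2"
      proof -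
        \<comment> \<open>The midpoint estimate: two points close to the supremum in value must be
          close to each other, as their midpoint would otherwise exceed it.\<close>
        have "F (ys i) / 2 + F (ys j) / 2 + \<sigma> / 8 * (nrm (ys i - ys j))\<^sup>2 \<le> ?S"
          using concave[OF ys(1) ys(1), of "1 / 2" i j] by simp
        then show ?thesis
          using N[OF that(1)] N[OF that(2)] ys(2)[of i] ys(2)[of j] by linarith
      qed
      then have "(nrm (ys i - ys j))\<^sup>2 < (m * e)\<^sup>2"
        using \<sigma> by simp
      then have "nrm (ys i - ys j) < m * e"
        by (rule power2_less_imp_less) (use m \<open>e > 0\<close> in simp)
      then have "m * norm (ys i - ys j) < m * e"
        using m(2)[of "ys i - ys j"] by linarith
      then show ?thesis
        using m(1) by (simp add: dist_norm)
    qed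
    then show "\<exists>M. \<forall>i\<ge>M. \<forall>j\<ge>M. dist (ys i) (ys j) < e"
      by blast
  qed
  then obtain z where z: "ys \<longlonglongrightarrow> z"
    using Cauchy_convergent convergent_def by blast
  have "F y + \<sigma> / 2 * (nrm (y - z))\<^sup>2 \<le> ?S" if y: "y \<in> Y" for y
  proof -
    have nlim: "(\<lambda>i. nrm (y - ys i)) \<longlonglongrightarrow> nrm (y - z)"
      using continuous_on_tendsto_compose[OF is_norm_continuous[OF n, of UNIV] tendsto_diff[OF tendsto_const z]]
      by simp
    \<comment> \<open>First \<open>i\<close> tends to infinity with \<open>t\<close> fixed, which
      replaces \<open>F (ys i)\<close> by the supremum; only afterwards does \<open>t\<close> tend
      to 0.\<close>
    have *: "F y + \<sigma> / 2 * (1 - t) * (nrm (y - z))\<^sup>2 \<le> ?S" if t: "0 < t" "t < 1" for t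
    proof -
      have "t * F y + (1 - t) * ?S + \<sigma> / 2 * t * (1 - t) * (nrm (y - z))\<^sup>2 \<le> ?S"
      proof (rule tendsto_upperbound[OF _ always_eventually])
        show "(\<lambda>i. t * F y + (1 - t) * F (ys i) + \<sigma> / 2 * t * (1 - t) * (nrm (y - ys i))\<^sup>2)
            \<longlonglongrightarrow> t * F y + (1 - t) * ?S + \<sigma> / 2 * t * (1 - t) * (nrm (y - z))\<^sup>2"
          by (intro tendsto_intros lim nlim)
        show "\<forall>i. t * F y + (1 - t) * F (ys i) + \<sigma> / 2 * t * (1 - t) * (nrm (y - ys i))\<^sup>2 \<le> ?S"
          using t by (intro allI concave y ys) auto
      qed simp
      then have "t * (F y + \<sigma> / 2 * (1 - t) * (nrm (y - z))\<^sup>2) \<le> t * ?S"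
        by (simp add: algebra_simps)
      then show ?thesis
        using t by simp
    qed
    have "((\<lambda>t. F y + \<sigma> / 2 * (1 - t) * (nrm (y - z))\<^sup>2)
        \<longlongrightarrow> F y + \<sigma> / 2 * (1 - 0) * (nrm (y - z))\<^sup>2) (at_right 0)"
      by (intro tendsto_intros)
    moreover have "\<forall>\<^sub>F t in at_right 0. F y + \<sigma> / 2 * (1 - t) * (nrm (y - z))\<^sup>2 \<le> ?S"
      unfolding eventually_at_right_field using * by (intro exI[of _ 1]) auto
    ultimately show ?thesis
      using tendsto_upperbound[OF _ _ trivial_limit_at_right_real] by fastforce
  qed
  then show thesis
    using that ys z lim by blast
qed

section \<open>Differentiability and smoothness of the conjugate\<close>

lemma GDERIV_of_quadratic_bound:
  fixes h :: "'a::euclidean_space \<Rightarrow> real"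
  assumes "\<And>y. \<bar>h y - h x - D \<bullet> (y - x)\<bar> \<le> C * (norm (y - x))\<^sup>2"
  shows "GDERIV h x :> D"
  unfolding gderiv_def has_derivative_at
proof
  show "bounded_linear (\<lambda>h. h \<bullet> D)"
    by (rule bounded_linear_inner_left)
  show "(\<lambda>d. norm (h (x + d) - h x - d \<bullet> D) / norm d) \<midarrow>0\<rightarrow> 0"
  proof (rule Lim_null_comparison)
    show "\<forall>\<^sub>F d in at 0. norm (norm (h (x + d) - h x - d \<bullet> D) / norm d) \<le> C * norm d"
      unfolding eventually_at_filter
      using assms[of "x + d" for d]
      by (intro always_eventually) (auto simp: inner_commute field_simps power2_eq_square)
    have "((\<lambda>d::'a. C * norm d) \<longlongrightarrow> C * norm (0::'a)) (at 0)"
      by (intro tendsto_intros)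
    then show "((\<lambda>d::'a. C * norm d) \<longlongrightarrow> 0) (at 0)"
      by simp
  qed
qed

lemma gradient_eqI: "GDERIV h x :> D \<Longrightarrow> gradient h x = D"
  unfolding gradient_def
proof (rule the_equality)
  fix D' assume "GDERIV h x :> D" "GDERIV h x :> D'"
  then have "(\<lambda>h. h \<bullet> D) = (\<lambda>h. h \<bullet> D')"
    unfolding gderiv_def by (rule has_derivative_unique)
  then have "h \<bullet> D = h \<bullet> D'" for h
    by metis
  then show "D' = D"
    by (metis euclidean_eqI inner_commute)
qed

text \<open>The slope at \<open>u\<close> is \<open>adjoint K z\<close>, with \<open>z\<close> the
  limit of a maximising sequence. Testing with that sequence bounds \<open>h\<close> from below;
  quadratic growth away from \<open>z\<close> bounds it from above. The sandwich also proves
  differentiability.\<close>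

lemma conjugate_smooth:
  fixes K :: "'a::euclidean_space \<Rightarrow> 'b::euclidean_space" and \<phi> :: "'b \<Rightarrow> real"
  assumes nX: "is_norm normX" and nY: "is_norm normY" and K: "linear K"
    and Y: "closed Y" "convex Y" "Y \<noteq> {}" and \<sigma>: "\<sigma> > 0"
    and sc: "strongly_convex_on normY \<sigma> Y \<phi>"
    and bdd: "\<And>x. bdd_above ((\<lambda>y. K x \<bullet> y - \<phi> y) ` Y)"
  defines "h \<equiv> \<lambda>x. SUP y\<in>Y. K x \<bullet> y - \<phi> y"
  shows "0 \<le> h x - linearization h (gradient h) u x"
    and "h x - linearization h (gradient h) u x \<le> (op_norm normX normY K)\<^sup>2 / \<sigma> / 2 * (normX (x - u))\<^sup>2"
proof -
  let ?k = "op_norm normX normY K"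
  have sc': "strongly_convex_on normY \<sigma> Y (\<lambda>y. - (K u \<bullet> y - \<phi> y))"
    using sc unfolding strongly_convex_on_def by (simp add: inner_add_right algebra_simps)
  have hu: "h u = (SUP y\<in>Y. K u \<bullet> y - \<phi> y)"
    by (simp add: h_def)
  obtain ys z where ys: "\<And>i. ys i \<in> Y" "ys \<longlonglongrightarrow> z" "(\<lambda>i. K u \<bullet> ys i - \<phi> (ys i)) \<longlonglongrightarrow> h u"
    "\<And>y. y \<in> Y \<Longrightarrow> (K u \<bullet> y - \<phi> y) + \<sigma> / 2 * (normY (y - z))\<^sup>2 \<le> h u"
    by (rule strongly_concave_sup[OF nY Y \<sigma> bdd sc', folded hu]) (rule that)
  \<comment> \<open>The value at \<open>z\<close> itself may fall short of the supremum, so the test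
    points are the \<open>ys i\<close> and the inequality passes to the limit.\<close>
  have low: "h u + K (w - u) \<bullet> z \<le> h w" for w
  proof (rule tendsto_upperbound[OF _ always_eventually])
    show "(\<lambda>i. (K u \<bullet> ys i - \<phi> (ys i)) + K (w - u) \<bullet> ys i) \<longlonglongrightarrow> h u + K (w - u) \<bullet> z"
      by (intro tendsto_intros ys)
    have eq: "(K u \<bullet> ys i - \<phi> (ys i)) + K (w - u) \<bullet> ys i = K w \<bullet> ys i - \<phi> (ys i)" for i
      by (simp add: linear_diff[OF K] inner_diff_left)
    then show "\<forall>i. (K u \<bullet> ys i - \<phi> (ys i)) + K (w - u) \<bullet> ys i \<le> h w"
      unfolding eq h_def by (intro allI cSUP_upper ys bdd)
  qed simp
  have upp: "h w \<le> h u + K (w - u) \<bullet> z + ?k\<^sup>2 / \<sigma> / 2 * (normX (w - u))\<^sup>2" for w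
  proof -
    have "(SUP y\<in>Y. K w \<bullet> y - \<phi> y) \<le> h u + K (w - u) \<bullet> z + ?k\<^sup>2 / \<sigma> / 2 * (normX (w - u))\<^sup>2"
    proof (rule cSUP_least[OF Y(3)])
      fix y assume y: "y \<in> Y"
      let ?a = "?k * normX (w - u)" and ?b = "normY (y - z)"
      \<comment> \<open>Young's inequality by completing the square: the growth term with modulus
        \<sigma> absorbs the part of the bilinear increment that depends on
        \<open>y - z\<close>.\<close>
      have "0 \<le> (?a - \<sigma> * ?b)\<^sup>2 / (2 * \<sigma>)"
        using \<sigma> by simp
      also have "\<dots> = ?k\<^sup>2 / \<sigma> / 2 * (normX (w - u))\<^sup>2 - ?a * ?b + \<sigma> / 2 * ?b\<^sup>2"
        using \<sigma> by (simp add: field_simps power2_eq_square)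
      finally have "?a * ?b \<le> ?k\<^sup>2 / \<sigma> / 2 * (normX (w - u))\<^sup>2 + \<sigma> / 2 * ?b\<^sup>2"
        by linarith
      moreover have "K (w - u) \<bullet> (y - z) \<le> ?a * ?b"
        using op_norm_bound(2)[OF nX nY K] .
      moreover have "K w \<bullet> y - \<phi> y = (K u \<bullet> y - \<phi> y) + K (w - u) \<bullet> z + K (w - u) \<bullet> (y - z)"
        by (simp add: linear_diff[OF K] inner_diff_left inner_diff_right)
      ultimately show "K w \<bullet> y - \<phi> y \<le> h u + K (w - u) \<bullet> z + ?k\<^sup>2 / \<sigma> / 2 * (normX (w - u))\<^sup>2"
        using ys(4)[OF y] by linarith
    qed
    then show ?thesis
      by (simp add: h_def)
  qed
  obtain C where C: "C > 0" "\<And>x. normX x \<le> C * norm x"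
    using is_norm_le_norm[OF nX] by blast
  have adj: "adjoint K z \<bullet> (w - u) = K (w - u) \<bullet> z" for w
    by (metis adjoint_works[OF K] inner_commute)
  have "GDERIV h u :> adjoint K z"
  proof (rule GDERIV_of_quadratic_bound)
    fix w
    have "(normX (w - u))\<^sup>2 \<le> (C * norm (w - u))\<^sup>2"
      using C(2)[of "w - u"] is_norm_nonneg[OF nX] by (intro power_mono)
    then have "?k\<^sup>2 / \<sigma> / 2 * (normX (w - u))\<^sup>2 \<le> ?k\<^sup>2 / \<sigma> / 2 * (C * norm (w - u))\<^sup>2"
      using \<sigma> by (intro mult_left_mono) auto
    then have "\<bar>h w - h u - adjoint K z \<bullet> (w - u)\<bar> \<le> ?k\<^sup>2 / \<sigma> / 2 * (C * norm (w - u))\<^sup>2"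
      using low[of w] upp[of w] by (simp only: adj)
    then show "\<bar>h w - h u - adjoint K z \<bullet> (w - u)\<bar> \<le> (?k\<^sup>2 / \<sigma> / 2 * C\<^sup>2) * (norm (w - u))\<^sup>2"
      by (simp only: power_mult_distrib mult.assoc)
  qed
  then have "linearization h (gradient h) u x = h u + K (x - u) \<bullet> z"
    using adj by (simp add: linearization_def gradient_eqI)
  then show "0 \<le> h x - linearization h (gradient h) u x"
    and "h x - linearization h (gradient h) u x \<le> ?k\<^sup>2 / \<sigma> / 2 * (normX (x - u))\<^sup>2"
    using low[of x] upp[of x] by simp_all
qed

text \<open>A bound on \<open>W y0\<close> forces \<open>Y\<close> to be bounded, hence
  \<open>J\<close> to be bounded below there, so all suprema are finite. The comparison then follows
  pointwise from the values of \<open>W y0\<close> lying between 0 and \<Omega>.\<close>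

lemma smoothed_max_bounds:
  fixes K :: "'a::euclidean_space \<Rightarrow> 'b::euclidean_space"
  assumes nY: "is_norm normY" and Y: "convex Y" and J: "convex_on Y J"
    and W: "prox_function normY Y \<omega> W" "\<omega> > 0" and y0: "y0 \<in> Y" and \<rho>: "\<rho> > 0"
    and \<Omega>: "\<And>y. y \<in> Y \<Longrightarrow> W y0 y \<le> \<Omega>"
  shows "bdd_above ((\<lambda>y. K x \<bullet> y - (J y + \<rho> * W y0 y)) ` Y)"
    and "smoothed_max K J Y W y0 \<rho> x \<le> (SUP y\<in>Y. K x \<bullet> y - J y)"
    and "(SUP y\<in>Y. K x \<bullet> y - J y) \<le> smoothed_max K J Y W y0 \<rho> x + \<rho> * \<Omega>"
proof -
  obtain c where c: "c > 0" "\<And>y. c * norm y \<le> normY y"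
    using norm_le_is_norm[OF nY] by blast
  have nonneg: "0 \<le> W y0 y" if "y \<in> Y" for y
    by (rule prox_function_nonneg[OF W(1) Y y0 that nY W(2)])
  have dist: "norm (y0 - y) \<le> sqrt (2 * \<Omega> / \<omega>) / c" if "y \<in> Y" for y
  proof -
    have "\<omega> / 2 * (normY (y0 - y))\<^sup>2 \<le> \<Omega>"
      using prox_function_lower[OF W(1) Y y0 that nY] \<Omega>[OF that] by linarith
    then have "(normY (y0 - y))\<^sup>2 \<le> 2 * \<Omega> / \<omega>"
      using W(2) by (simp add: field_simps)
    then have "normY (y0 - y) \<le> sqrt (2 * \<Omega> / \<omega>)"
      by (rule real_le_rsqrt)
    then have "c * norm (y0 - y) \<le> sqrt (2 * \<Omega> / \<omega>)"
      using c(2)[of "y0 - y"] by linarith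
    then show ?thesis
      using c(1) by (simp add: pos_le_divide_eq mult.commute)
  qed
  then have "bounded Y"
    by (intro boundedI[of Y "norm y0 + sqrt (2 * \<Omega> / \<omega>) / c"])
      (smt (verit) norm_triangle_sub norm_minus_commute)
  then obtain B where B: "B > 0" "\<And>y. y \<in> Y \<Longrightarrow> norm y \<le> B"
    by (auto simp: bounded_pos)
  obtain j where j: "\<And>y. y \<in> Y \<Longrightarrow> j \<le> J y"
    using convex_on_bounded_imp_bdd_below[OF J \<open>bounded Y\<close> y0] by blast
  have up: "K x \<bullet> y - J y \<le> norm (K x) * B - j" if "y \<in> Y" for y
    using norm_cauchy_schwarz[of "K x" y] mult_left_mono[OF B(2)[OF that], of "norm (K x)"] j[OF that]
    by simp
  have bdd0: "bdd_above ((\<lambda>y. K x \<bullet> y - J y) ` Y)"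
    using up by (intro bdd_aboveI2)
  have le: "K x \<bullet> y - J y - \<rho> * W y0 y \<le> K x \<bullet> y - J y" if "y \<in> Y" for y
    using nonneg[OF that] \<rho> by simp
  have bdd: "bdd_above ((\<lambda>y. K x \<bullet> y - J y - \<rho> * W y0 y) ` Y)"
    using up le by (intro bdd_aboveI2[of _ _ "norm (K x) * B - j"]) force
  then show "bdd_above ((\<lambda>y. K x \<bullet> y - (J y + \<rho> * W y0 y)) ` Y)"
    by (simp add: diff_diff_eq)
  show "smoothed_max K J Y W y0 \<rho> x \<le> (SUP y\<in>Y. K x \<bullet> y - J y)"
    unfolding smoothed_max_def using y0 bdd0 by (intro cSUP_mono) (auto intro: le)
  show "(SUP y\<in>Y. K x \<bullet> y - J y) \<le> smoothed_max K J Y W y0 \<rho> x + \<rho> * \<Omega>"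
  proof (rule cSUP_least)
    fix y assume y: "y \<in> Y"
    have "K x \<bullet> y - J y - \<rho> * W y0 y \<le> smoothed_max K J Y W y0 \<rho> x"
      unfolding smoothed_max_def using y bdd by (rule cSUP_upper)
    moreover have "\<rho> * W y0 y \<le> \<rho> * \<Omega>"
      using \<Omega>[OF y] \<rho> by simp
    ultimately show "K x \<bullet> y - J y \<le> smoothed_max K J Y W y0 \<rho> x + \<rho> * \<Omega>"
      by linarith
  qed (use y0 in auto)
qed

section \<open>One outer iteration\<close>

text \<open>A weighted Cauchy-Schwarz inequality free of square roots: the cross term is controlled
  by the arithmetic-geometric mean of \<open>c * s\<close> and \<open>r\<close>.\<close>

lemma weighted_mean_square:
  fixes D E :: real
  assumes a: "0 \<le> a" "a \<le> 1" and c: "0 \<le> c" "0 \<le> r" and D: "D\<^sup>2 \<le> c * r" and E: "E\<^sup>2 \<le> s"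
  shows "((1 - a) * D + a * E)\<^sup>2 \<le> ((1 - a) * c + a) * ((1 - a) * r + a * s)"
proof -
  have s: "0 \<le> s"
    using E zero_le_power2 order_trans by blast
  have "(D * E)\<^sup>2 \<le> (c * r) * s"
    unfolding power_mult_distrib using D E c by (intro mult_mono) auto
  also have "\<dots> = (c * s) * r"
    by simp
  also have "\<dots> \<le> ((c * s + r) / 2)\<^sup>2"
    using zero_le_power2[of "(c * s - r) / 2"] by (simp add: power2_eq_square field_simps)
  finally have "D * E \<le> (c * s + r) / 2"
    by (rule power2_le_imp_le) (use c s in simp)
  then have "(1 - a) * a * (2 * (D * E)) \<le> (1 - a) * a * (c * s + r)"
    using a by (intro mult_left_mono) auto
  moreover have "(1 - a)\<^sup>2 * D\<^sup>2 \<le> (1 - a)\<^sup>2 * (c * r)" "a\<^sup>2 * E\<^sup>2 \<le> a\<^sup>2 * s"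
    using D E by (auto intro: mult_left_mono)
  ultimately show ?thesis
    by (simp add: power2_eq_square algebra_simps)
qed

text \<open>Isolates what the convergence analysis uses about \<open>h\<close>, apart from its
  saddle structure. Its bounds are asked for on the whole space, so points of linearisation need not
  be placed in \<open>X\<close>.\<close>

locale composite =
  fixes nrm :: "'a::euclidean_space \<Rightarrow> real" and X :: "'a set" and \<nu> :: real and V :: "'a \<Rightarrow> 'a \<Rightarrow> real"
    and h :: "'a \<Rightarrow> real" and M :: real
  assumes nrm: "is_norm nrm" and X: "closed X" "convex X"
    and \<nu>: "\<nu> > 0" and V: "prox_function nrm X \<nu> V"
    and M: "M > 0"
    and h_lower: "\<And>x u. 0 \<le> h x - linearization h (gradient h) u x"
    and h_upper: "\<And>x u. h x - linearization h (gradient h) u x \<le> M / 2 * (nrm (x - u))\<^sup>2"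
begin

lemma V_lower: "x \<in> X \<Longrightarrow> u \<in> X \<Longrightarrow> \<nu> / 2 * (nrm (x - u))\<^sup>2 \<le> V x u"
  using prox_function_lower[OF V X(2) _ _ nrm] .

lemma V_nonneg: "x \<in> X \<Longrightarrow> u \<in> X \<Longrightarrow> 0 \<le> V x u"
  using prox_function_nonneg[OF V X(2) _ _ nrm \<nu>] .

text \<open>\<open>G\<close> measures the gap of \<open>h + g\<close> at the point that the outer
  iteration would produce from \<open>ut\<close>. The prox term \<open>d * V u w\<close> pays for
  the curvature of \<open>h\<close>, which is what \<open>Md\<close> provides; convexity of
  \<open>h\<close> handles the rest.\<close>

lemma inner_step:
  fixes g :: "'a \<Rightarrow> real" and b :: real and a ut :: 'a
  assumes g: "\<And>v. g v = b + a \<bullet> v"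
    and pts: "xb \<in> X" "x \<in> X" "u \<in> X" "v \<in> X"
    and lam: "0 < lam" "lam \<le> 1" and \<beta>: "\<beta> > 0" and \<alpha>: "0 < \<alpha>" "\<alpha> \<le> 1" and d: "d \<ge> 0"
    and Md: "M * lam * \<alpha> \<le> \<nu> * d"
  defines "G \<equiv> \<lambda>ut. h ((1 - lam) *\<^sub>R xb + lam *\<^sub>R ut) - (1 - lam) * h xb - lam * h v + lam * (g ut - g v)"
    and "um \<equiv> (1 - lam) *\<^sub>R xb + (lam * (1 - \<alpha>)) *\<^sub>R ut + (lam * \<alpha>) *\<^sub>R u"
  defines "w \<equiv> arg_min_on (\<lambda>v. g v + linearization h (gradient h) um v + \<beta> * V x v + d * V u v) X"
  shows "w \<in> X"
    and "G ((1 - \<alpha>) *\<^sub>R ut + \<alpha> *\<^sub>R w) + lam * (\<alpha> * (\<beta> + d)) * V w v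
      \<le> (1 - \<alpha>) * G ut + lam * (\<alpha> * d) * V u v + \<alpha> * lam * \<beta> * (V x v - V x w)"
proof -
  let ?l = "linearization h (gradient h) um"
  let ?q = "\<lambda>z. (1 - lam) *\<^sub>R xb + lam *\<^sub>R z"
  let ?ut' = "(1 - \<alpha>) *\<^sub>R ut + \<alpha> *\<^sub>R w"
  have l: "(\<lambda>v. g v + ?l v) v = (b + h um - gradient h um \<bullet> um) + (a + gradient h um) \<bullet> v" for v
    by (simp add: linearization_def g inner_diff_right inner_add_left)
  show w: "w \<in> X"
    unfolding w_def by (rule prox_step_minimizer(1)[OF nrm X V \<nu> l pts(2,3) \<beta> d])
  have opt: "g w + ?l w + \<beta> * V x w + d * V u w + (\<beta> + d) * V w v \<le> g v + ?l v + \<beta> * V x v + d * V u v"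
    unfolding w_def using prox_step_three_point[OF nrm X V \<nu> l pts(2,3) \<beta> d pts(4)] .
  \<comment> \<open>The extrapolated point differs from the new one only in having \<open>u\<close>
    where the latter has \<open>w\<close>, so the curvature error is measured by
    \<open>w - u\<close>.\<close>
  have "?q ?ut' - um = (lam * \<alpha>) *\<^sub>R (w - u)"
    unfolding um_def by (simp add: algebra_simps)
  then have "(nrm (?q ?ut' - um))\<^sup>2 = (lam * \<alpha>)\<^sup>2 * (nrm (w - u))\<^sup>2"
    by (simp add: is_norm_scale[OF nrm] power_mult_distrib)
  then have "h (?q ?ut') \<le> ?l (?q ?ut') + M / 2 * ((lam * \<alpha>)\<^sup>2 * (nrm (w - u))\<^sup>2)"
    using h_upper[of "?q ?ut'" um] by simp
  also have "M / 2 * ((lam * \<alpha>)\<^sup>2 * (nrm (w - u))\<^sup>2) \<le> (lam * \<alpha>) * (d * V u w)"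
  proof -
    have "M / 2 * ((lam * \<alpha>)\<^sup>2 * (nrm (w - u))\<^sup>2) = (lam * \<alpha>) * ((M * lam * \<alpha>) * ((nrm (w - u))\<^sup>2 / 2))"
      by (simp add: power2_eq_square)
    also have "\<dots> \<le> (lam * \<alpha>) * ((\<nu> * d) * ((nrm (w - u))\<^sup>2 / 2))"
      using lam \<alpha> Md by (intro mult_left_mono mult_right_mono) auto
    also have "\<dots> = (lam * \<alpha>) * (d * (\<nu> / 2 * (nrm (u - w))\<^sup>2))"
      by (simp add: is_norm_minus_commute[OF nrm, of w u])
    also have "\<dots> \<le> (lam * \<alpha>) * (d * V u w)"
      using lam \<alpha> d V_lower[OF pts(3) w] by (intro mult_left_mono) auto
    finally show ?thesis .
  qed
  \<comment> \<open>The new point is a convex combination of \<open>?q ut\<close>, \<open>xb\<close>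
    and \<open>w\<close>, and the linearisation is affine. Only at \<open>w\<close> is it kept, to
    be met by the prox inequality.\<close>
  also have "?l (?q ?ut') = (1 - \<alpha>) * ?l (?q ut) + \<alpha> * (1 - lam) * ?l xb + \<alpha> * lam * ?l w"
    by (simp add: linearization_def inner_add_right inner_diff_right algebra_simps)
  also have "\<dots> \<le> (1 - \<alpha>) * h (?q ut) + \<alpha> * (1 - lam) * h xb + \<alpha> * lam * ?l w"
    using lam \<alpha> h_lower[of "?q ut" um] h_lower[of xb um] by (intro add_mono mult_left_mono) auto
  finally have "h (?q ?ut') \<le> (1 - \<alpha>) * h (?q ut) + \<alpha> * (1 - lam) * h xb + \<alpha> * lam * ?l w + lam * \<alpha> * (d * V u w)"
    by simp
  moreover have "\<alpha> * lam * (g w + ?l w + \<beta> * V x w + d * V u w + (\<beta> + d) * V w v)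
      \<le> \<alpha> * lam * (g v + h v + \<beta> * V x v + d * V u v)"
    using opt lam \<alpha> h_lower[of v um] by (intro mult_left_mono) auto
  moreover have "lam * g ?ut' = (1 - \<alpha>) * (lam * g ut) + \<alpha> * (lam * g w)"
    by (simp add: g inner_add_right algebra_simps)
  ultimately show "G ?ut' + lam * (\<alpha> * (\<beta> + d)) * V w v
      \<le> (1 - \<alpha>) * G ut + lam * (\<alpha> * d) * V u v + \<alpha> * lam * \<beta> * (V x v - V x w)"
    unfolding G_def by (simp add: algebra_simps)
qed

text \<open>The weighted average \<open>R\<close> of the distances \<open>V x (u s)\<close>, gained from the term \<open>\<beta> V x\<close> of the inner
  problem, later absorbs the error of linearising \<open>f\<close>.\<close>

lemma prox_ag_invariant:
  fixes g :: "'a \<Rightarrow> real" and b :: real and a :: 'a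
  assumes g: "\<And>v. g v = b + a \<bullet> v"
    and pts: "xb \<in> X" "x \<in> X" "v \<in> X"
    and lam: "0 < lam" "lam \<le> 1" and \<beta>: "\<beta> > 0"
    and \<alpha>: "\<And>t. t \<ge> 1 \<Longrightarrow> 0 < \<alpha> t \<and> \<alpha> t \<le> 1"
    and d: "\<And>t. t \<ge> 1 \<Longrightarrow> 0 \<le> \<beta> * p t + q t"
    and Md: "\<And>t. t \<ge> 1 \<Longrightarrow> M * lam * \<alpha> t \<le> \<nu> * (\<beta> * p t + q t)"
    and rec: "\<And>t. t \<ge> 1 \<Longrightarrow> \<alpha> (Suc t) * (\<beta> * p (Suc t) + q (Suc t))
      = (1 - \<alpha> (Suc t)) * (\<alpha> t * (\<beta> + (\<beta> * p t + q t)))"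
  defines "G \<equiv> \<lambda>ut. h ((1 - lam) *\<^sub>R xb + lam *\<^sub>R ut) - (1 - lam) * h xb - lam * h v + lam * (g ut - g v)"
    and "P \<equiv> prox_ag X V h g xb x lam \<beta> \<alpha> p q"
    and "\<Lambda> \<equiv> \<lambda>t. \<Prod>s=1..t. 1 - \<alpha> s"
    and "\<kappa> \<equiv> \<lambda>t. \<alpha> t * (\<beta> + (\<beta> * p t + q t))"
  shows "fst (P t) \<in> X \<and> snd (P t) \<in> X \<and> (\<exists>R\<ge>0.
      \<nu> / 2 * (nrm (snd (P t) - xb + (1 - \<Lambda> t) *\<^sub>R (xb - x)))\<^sup>2 \<le> (1 - \<Lambda> t) * R \<and>
      G (snd (P t)) + lam * \<kappa> t * V (fst (P t)) v \<le> \<Lambda> t * G xb + lam * \<kappa> t * V x v - lam * \<beta> * R)"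
proof (induction t)
  case 0
  then show ?case
    using pts by (auto simp: P_def \<Lambda>_def is_norm_0[OF nrm] intro!: exI[of _ 0])
next
  case (Suc t)
  obtain u ut where ut: "P t = (u, ut)"
    by (cases "P t")
  from Suc obtain R where u: "u \<in> X" "ut \<in> X" and R: "R \<ge> 0"
    and dR: "\<nu> / 2 * (nrm (ut - xb + (1 - \<Lambda> t) *\<^sub>R (xb - x)))\<^sup>2 \<le> (1 - \<Lambda> t) * R"
    and GR: "G ut + lam * \<kappa> t * V u v \<le> \<Lambda> t * G xb + lam * \<kappa> t * V x v - lam * \<beta> * R"
    by (auto simp: ut)
  let ?a = "\<alpha> (Suc t)" and ?d = "\<beta> * p (Suc t) + q (Suc t)"
  define um where "um = (1 - lam) *\<^sub>R xb + (lam * (1 - ?a)) *\<^sub>R ut + (lam * ?a) *\<^sub>R u"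
  define w where "w = arg_min_on (\<lambda>v. g v + linearization h (gradient h) um v + \<beta> * V x v + ?d * V u v) X"
  let ?ut' = "(1 - ?a) *\<^sub>R ut + ?a *\<^sub>R w"
  have PS: "P (Suc t) = (w, ?ut')"
    using ut by (simp add: P_def w_def um_def Let_def)
  have a: "0 < ?a" "?a \<le> 1" and d': "0 \<le> ?d" and Md': "M * lam * ?a \<le> \<nu> * ?d"
    using \<alpha> d Md by auto
  have w: "w \<in> X"
    unfolding w_def um_def by (rule inner_step(1)[OF g pts(1,2) u(1) pts(3) lam \<beta> a d' Md'])
  have step: "G ?ut' + lam * \<kappa> (Suc t) * V w v
      \<le> (1 - ?a) * G ut + lam * (?a * ?d) * V u v + ?a * lam * \<beta> * (V x v - V x w)"
    unfolding w_def um_def G_def \<kappa>_def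
    by (rule inner_step(2)[OF g pts(1,2) u(1) pts(3) lam \<beta> a d' Md'])
  have ut': "?ut' \<in> X"
    using X(2) u w a by (intro convexD) auto
  have \<Lambda>S: "\<Lambda> (Suc t) = (1 - ?a) * \<Lambda> t"
    by (simp add: \<Lambda>_def)
  have "\<Lambda> t \<le> 1"
    unfolding \<Lambda>_def using \<alpha> by (intro prod_le_1) force
  \<comment> \<open>The average is updated with the same weights as the running average of the
    iterates.\<close>
  let ?R = "(1 - ?a) * R + ?a * V x w"
  have Vx: "0 \<le> V x w"
    by (rule V_nonneg[OF pts(2) w])
  have "\<nu> / 2 * (nrm (?ut' - xb + (1 - \<Lambda> (Suc t)) *\<^sub>R (xb - x)))\<^sup>2 \<le> (1 - \<Lambda> (Suc t)) * ?R"
  proof -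
    let ?D = "ut - xb + (1 - \<Lambda> t) *\<^sub>R (xb - x)"
    \<comment> \<open>The shift by a multiple of \<open>xb - x\<close> is chosen so that these
      displacements average too, each new one being \<open>w - x\<close>; hence they can be compared
      with \<open>R\<close>.\<close>
    have "?ut' - xb + (1 - \<Lambda> (Suc t)) *\<^sub>R (xb - x) = (1 - ?a) *\<^sub>R ?D + ?a *\<^sub>R (w - x)"
      unfolding \<Lambda>S by (simp add: algebra_simps)
    then have "nrm (?ut' - xb + (1 - \<Lambda> (Suc t)) *\<^sub>R (xb - x)) \<le> (1 - ?a) * nrm ?D + ?a * nrm (w - x)"
      using is_norm_triangle[OF nrm, of "(1 - ?a) *\<^sub>R ?D" "?a *\<^sub>R (w - x)"] a
      by (simp add: is_norm_scale[OF nrm])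
    then have "(nrm (?ut' - xb + (1 - \<Lambda> (Suc t)) *\<^sub>R (xb - x)))\<^sup>2 \<le> ((1 - ?a) * nrm ?D + ?a * nrm (w - x))\<^sup>2"
      using is_norm_nonneg[OF nrm] by (intro power_mono)
    also have "\<dots> \<le> ((1 - ?a) * (1 - \<Lambda> t) + ?a) * ((1 - ?a) * (2 / \<nu> * R) + ?a * (2 / \<nu> * V x w))"
    proof (rule weighted_mean_square)
      show "(nrm ?D)\<^sup>2 \<le> (1 - \<Lambda> t) * (2 / \<nu> * R)"
        using dR \<nu> by (simp add: field_simps)
      show "(nrm (w - x))\<^sup>2 \<le> 2 / \<nu> * V x w"
        using V_lower[OF pts(2) w] \<nu> by (simp add: is_norm_minus_commute[OF nrm, of w x] field_simps)
    qed (use a R \<nu> \<open>\<Lambda> t \<le> 1\<close> in auto)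
    also have "\<dots> = 2 / \<nu> * ((1 - \<Lambda> (Suc t)) * ?R)"
      unfolding \<Lambda>S using \<nu> by (simp add: field_simps)
    finally show ?thesis
      using \<nu> by (simp add: field_simps)
  qed
  moreover have "G ?ut' + lam * \<kappa> (Suc t) * V w v
      \<le> \<Lambda> (Suc t) * G xb + lam * \<kappa> (Suc t) * V x v - lam * \<beta> * ?R"
  proof -
    \<comment> \<open>The parameter recursion starts at index 1, and \<kappa> at 0 rests on
      arbitrary parameter values. There \<open>u = x\<close>, so both sides vanish.\<close>
    have shift: "(?a * ?d) * (V u v - V x v) = ((1 - ?a) * \<kappa> t) * (V u v - V x v)"
    proof (cases "t = 0")
      case True
      then have "u = x"
        using ut by (simp add: P_def)
      then show ?thesis
        by simp
    next
      case False
      then show ?thesis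
        using rec[of t] by (simp add: \<kappa>_def)
    qed
    have "(1 - ?a) * (G ut + lam * \<kappa> t * V u v) \<le> (1 - ?a) * (\<Lambda> t * G xb + lam * \<kappa> t * V x v - lam * \<beta> * R)"
      using GR a by (intro mult_left_mono) auto
    moreover have "lam * ((?a * ?d) * (V u v - V x v)) = lam * (((1 - ?a) * \<kappa> t) * (V u v - V x v))"
      using shift by simp
    moreover have "lam * \<kappa> (Suc t) * V x v = lam * (?a * ?d) * V x v + ?a * lam * \<beta> * V x v"
      by (simp add: \<kappa>_def algebra_simps)
    ultimately show ?thesis
      using step unfolding \<Lambda>S by (simp add: algebra_simps)
  qed
  moreover have "0 \<le> ?R"
    using a R Vx by auto
  ultimately show ?case
    unfolding PS fst_conv snd_conv using w ut' by blast
qed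

text \<open>The quadratic error of linearising \<open>f\<close> at \<open>xm\<close> is at most
  \<open>lam * \<beta> * R\<close>, precisely the gain that the inner loop has set aside; the
  condition relating \<open>L * \<gamma>\<close> to \<open>\<beta> * \<nu>\<close> makes this
  fit.\<close>

lemma outer_step:
  fixes f :: "'a \<Rightarrow> real" and Gf :: "'a \<Rightarrow> 'a" and L :: real
  assumes L: "L > 0"
    and f_lower: "\<And>x u. x \<in> X \<Longrightarrow> u \<in> X \<Longrightarrow> 0 \<le> f x - linearization f Gf u x"
    and f_upper: "\<And>x u. x \<in> X \<Longrightarrow> u \<in> X \<Longrightarrow> f x - linearization f Gf u x \<le> L / 2 * (nrm (x - u))\<^sup>2"
    and pts: "xb \<in> X" "x \<in> X" "v \<in> X"
    and lam: "0 < lam" "lam \<le> 1" and \<beta>: "\<beta> > 0"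
    and \<alpha>: "\<And>t. t \<ge> 1 \<Longrightarrow> 0 < \<alpha> t \<and> \<alpha> t \<le> 1"
    and d: "\<And>t. t \<ge> 1 \<Longrightarrow> 0 \<le> \<beta> * p t + q t"
    and Md: "\<And>t. t \<ge> 1 \<Longrightarrow> M * lam * \<alpha> t \<le> \<nu> * (\<beta> * p t + q t)"
    and rec: "\<And>t. t \<ge> 1 \<Longrightarrow> \<alpha> (Suc t) * (\<beta> * p (Suc t) + q (Suc t))
      = (1 - \<alpha> (Suc t)) * (\<alpha> t * (\<beta> + (\<beta> * p t + q t)))"
    and \<gamma>: "\<gamma> = lam * (1 - (\<Prod>s=1..T. 1 - \<alpha> s))" "0 \<le> \<gamma>" "\<gamma> \<le> 1" "L * \<gamma> \<le> \<beta> * \<nu>"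
  defines "xm \<equiv> (1 - \<gamma>) *\<^sub>R xb + \<gamma> *\<^sub>R x"
  defines "P \<equiv> prox_ag X V h (linearization f Gf xm) xb x lam \<beta> \<alpha> p q T"
  defines "xb' \<equiv> (1 - lam) *\<^sub>R xb + lam *\<^sub>R snd P"
    and "\<kappa> \<equiv> \<alpha> T * (\<beta> + (\<beta> * p T + q T))"
  shows "fst P \<in> X" and "xb' \<in> X"
    and "f xb' + h xb' - (f v + h v) + lam * \<kappa> * V (fst P) v
      \<le> (1 - \<gamma>) * (f xb + h xb - (f v + h v)) + lam * \<kappa> * V x v"
proof -
  let ?g = "linearization f Gf xm" and ?\<Lambda> = "\<Prod>s=1..T. 1 - \<alpha> s"
  have g: "?g v = (f xm - Gf xm \<bullet> xm) + Gf xm \<bullet> v" for v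
    by (simp add: linearization_def inner_diff_right)
  obtain xt where xt: "snd P = xt"
    by blast
  have xm: "xm \<in> X"
    unfolding xm_def using X(2) pts \<gamma> by (intro convexD) auto
  from prox_ag_invariant[where g = ?g and xb = xb and x = x and v = v and lam = lam and \<beta> = \<beta>
      and \<alpha> = \<alpha> and p = p and q = q and t = T, OF g pts lam \<beta> \<alpha> d Md rec, folded P_def \<kappa>_def]
  obtain R where P: "fst P \<in> X" "xt \<in> X" and R: "R \<ge> 0"
    and dR: "\<nu> / 2 * (nrm (xt - xb + (1 - ?\<Lambda>) *\<^sub>R (xb - x)))\<^sup>2 \<le> (1 - ?\<Lambda>) * R"
    and GR: "h xb' - (1 - lam) * h xb - lam * h v + lam * (?g xt - ?g v) + lam * \<kappa> * V (fst P) v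
      \<le> ?\<Lambda> * (h ((1 - lam) *\<^sub>R xb + lam *\<^sub>R xb) - (1 - lam) * h xb - lam * h v + lam * (?g xb - ?g v))
        + lam * \<kappa> * V x v - lam * \<beta> * R"
    unfolding xb'_def xt by blast
  show "fst P \<in> X"
    by fact
  show xb': "xb' \<in> X"
    unfolding xb'_def xt using X(2) pts P lam by (intro convexD) auto
  have "(1 - lam) *\<^sub>R xb + lam *\<^sub>R xb = xb"
    by (simp add: algebra_simps)
  note GR = GR[unfolded this]
  \<comment> \<open>The definition of \<gamma> makes the shift in the inner invariant coincide with
    the position of \<open>xm\<close>.\<close>
  have "xb' - xm = lam *\<^sub>R (xt - xb + (1 - ?\<Lambda>) *\<^sub>R (xb - x))"
    unfolding xb'_def xm_def xt \<gamma>(1) by (simp add: algebra_simps)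
  then have "L / 2 * (nrm (xb' - xm))\<^sup>2 = L * lam\<^sup>2 / \<nu> * (\<nu> / 2 * (nrm (xt - xb + (1 - ?\<Lambda>) *\<^sub>R (xb - x)))\<^sup>2)"
    using \<nu> by (simp add: is_norm_scale[OF nrm] power_mult_distrib)
  also have "\<dots> \<le> L * lam\<^sup>2 / \<nu> * ((1 - ?\<Lambda>) * R)"
    using L \<nu> by (intro mult_left_mono dR) auto
  also have "\<dots> = (L * \<gamma>) * (lam * R / \<nu>)"
    unfolding \<gamma>(1) by (simp add: power2_eq_square)
  also have "\<dots> \<le> (\<beta> * \<nu>) * (lam * R / \<nu>)"
    using \<gamma>(4) lam R \<nu> by (intro mult_right_mono) auto
  also have "\<dots> = lam * \<beta> * R"
    using \<nu> by simp
  finally have "f xb' \<le> ?g xb' + lam * \<beta> * R"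
    using f_upper[OF xb' xm] by simp
  moreover have "?g xb' = (1 - lam) * ?g xb + lam * ?g xt"
    unfolding g xb'_def xt by (simp add: inner_add_right algebra_simps)
  moreover have "(1 - \<gamma>) * ?g xb \<le> (1 - \<gamma>) * f xb" "\<gamma> * ?g v \<le> \<gamma> * f v"
    using f_lower[OF pts(1) xm] f_lower[OF pts(3) xm] \<gamma>(2,3) by (auto intro: mult_left_mono)
  \<comment> \<open>The product times \<open>lam\<close> is \<open>lam - \<gamma>\<close>, which
    turns the weight of the old gap into \<open>1 - \<gamma>\<close>.\<close>
  moreover have "?\<Lambda> * (h xb - (1 - lam) * h xb - lam * h v + lam * (?g xb - ?g v))
      = (lam - \<gamma>) * (h xb - h v + (?g xb - ?g v))"
    unfolding \<gamma>(1) by (simp add: algebra_simps)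
  ultimately show "f xb' + h xb' - (f v + h v) + lam * \<kappa> * V (fst P) v
      \<le> (1 - \<gamma>) * (f xb + h xb - (f v + h v)) + lam * \<kappa> * V x v"
    using GR by (simp add: algebra_simps)
qed

end

section \<open>The parameters and the rate of convergence\<close>

lemma ags_T_1:
  assumes "L > 0" "M > 0"
  shows "ags_T L M 1 \<ge> 1" and "8 * M \<le> 7 * L * (real (ags_T L M 1))\<^sup>2"
proof -
  let ?c = "sqrt (8 * M / (7 * L))"
  have c: "?c > 0"
    using assms by simp
  then show "ags_T L M 1 \<ge> 1"
    unfolding ags_T_def by (simp add: Suc_le_eq)
  have "?c \<le> real (ags_T L M 1)"
    unfolding ags_T_def by simp linarith
  then have "?c\<^sup>2 \<le> (real (ags_T L M 1))\<^sup>2"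
    using c by (intro power_mono) auto
  then show "8 * M \<le> 7 * L * (real (ags_T L M 1))\<^sup>2"
    using assms by (simp add: field_simps)
qed

text \<open>The loop length is the logarithm of \<open>1 / 3\<close> to the base
  \<open>1 - \<alpha>\<close>, rounded up. Contraction by a third keeps \<open>lam\<close> within a
  factor \<open>3 / 2\<close> of \<gamma>.\<close>

lemma ags_T_later:
  assumes "L > 0" "M > 0" "k \<noteq> 1"
  shows "(1 - 1 / (sqrt (M / L) + 1)) ^ ags_T L M k \<le> 1 / 3"
proof -
  define \<alpha> where "\<alpha> = 1 / (sqrt (M / L) + 1)"
  have \<alpha>: "0 < \<alpha>" "\<alpha> < 1"
    using assms by (auto simp: \<alpha>_def field_simps add_pos_pos)
  then have l: "- ln (1 - \<alpha>) > 0"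
    by simp
  have "ln 3 / - ln (1 - \<alpha>) \<le> real (ags_T L M k)"
    using assms(3) unfolding ags_T_def \<alpha>_def by simp linarith
  then have "ln 3 \<le> real (ags_T L M k) * - ln (1 - \<alpha>)"
    using l by (simp only: pos_divide_le_eq)
  then have "ln ((1 - \<alpha>) ^ ags_T L M k) \<le> ln (1 / 3)"
    using \<alpha> by (simp add: ln_realpow ln_div)
  then show ?thesis
    using \<alpha> unfolding \<alpha>_def[symmetric] by (subst (asm) ln_le_cancel_iff) auto
qed

lemma ags_T_le:
  assumes L: "L > 0" "L \<le> M"
  shows "real (ags_T L M k) \<le> 41 / 25 * (sqrt (M / L) + 1)"
proof -
  define p where "p = sqrt (M / L)"
  have p: "p \<ge> 1"
    using L by (simp add: p_def)
  have "real (ags_T L M k) \<le> 41 / 25 * (p + 1)"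
  proof (cases "k = 1")
    case True
    have "sqrt (8 * M / (7 * L)) = sqrt (8 / 7) * p"
      by (simp add: p_def flip: real_sqrt_mult)
    also have "\<dots> \<le> 11 / 10 * p"
      using p by (intro mult_right_mono real_le_lsqrt) (auto simp: power2_eq_square)
    finally have "real (ags_T L M k) \<le> 11 / 10 * p + 1"
      using True L unfolding ags_T_def by (simp del: real_sqrt_divide) linarith
    then show ?thesis
      using p by (simp add: algebra_simps)
  next
    case False
    define \<alpha> where "\<alpha> = 1 / (p + 1)"
    have \<alpha>: "0 < \<alpha>" "\<alpha> < 1"
    proof -
      have "0 < 1 / x \<and> 1 / x < 1" if "1 < x" for x :: real
        using that by simp
      moreover have "1 < p + 1"
        using p by linarith
      ultimately show "0 < \<alpha>" "\<alpha> < 1"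
        unfolding \<alpha>_def by blast+
    qed
    \<comment> \<open>A rational certificate that \<open>ln 3\<close> is at most 1.14, from the
      compound interest bound for \<open>exp\<close> with 16 periods.\<close>
    have "(3::real) \<le> (1 + (57 / 50) / 16) ^ 16"
      by (simp add: power_divide)
    also have "\<dots> \<le> exp (57 / 50)"
      using exp_ge_one_plus_x_over_n_power_n[of 16 "57 / 50"] by simp
    finally have "ln 3 \<le> ln (exp (57 / 50 :: real))"
      by (subst ln_le_cancel_iff) auto
    then have "ln 3 \<le> (57 / 50 :: real)"
      by simp
    moreover have "\<alpha> \<le> - ln (1 - \<alpha>)"
      using ln_le_minus_one[of "1 - \<alpha>"] \<alpha> by simp
    ultimately have "ln 3 / - ln (1 - \<alpha>) \<le> (57 / 50) / \<alpha>"
      using \<alpha> by (intro frac_le) auto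
    also have "\<dots> = 57 / 50 * (p + 1)"
      using p by (simp add: \<alpha>_def)
    finally have "ln 3 / - ln (1 - \<alpha>) \<le> 57 / 50 * (p + 1)" .
    moreover have "0 \<le> ln 3 / - ln (1 - \<alpha>)"
      using \<alpha> by (intro divide_nonneg_pos) auto
    moreover have "ags_T L M k = nat \<lceil>ln 3 / - ln (1 - \<alpha>)\<rceil>"
      using False by (simp only: ags_T_def \<alpha>_def p_def if_False)
    ultimately have "real (ags_T L M k) \<le> 57 / 50 * (p + 1) + 1"
      by linarith
    \<comment> \<open>Rounding up costs 1, which is at most half of \<open>p + 1\<close> since
      \<open>p\<close> is at least 1; and \<open>57 / 50 + 1 / 2 = 41 / 25\<close>.\<close>
    also have "\<dots> \<le> 41 / 25 * (p + 1)"
      using p by (simp add: field_simps)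
    finally show ?thesis .
  qed
  then show ?thesis
    by (simp only: p_def)
qed

section \<open>Admissibility of the parameters\<close>

context
  fixes L M \<nu> :: real
  assumes L: "L > 0" and M: "M > 0" and \<nu>: "\<nu> > 0"
begin

text \<open>These are the hypotheses of \<open>outer_step\<close>; the last equation says that the
  prox weight, scaled by \<open>k * (k + 1)\<close>, is independent of \<open>k\<close>, so that
  successive potentials match.\<close>

lemma ags_params_first:
  defines "lam \<equiv> ags_lam L M 1" and "\<beta> \<equiv> ags_\<beta> L M \<nu> 1" and "\<alpha> \<equiv> ags_\<alpha> L M 1" and "p \<equiv> ags_p L M 1"
    and "q \<equiv> ags_q L M \<nu> 1" and "T \<equiv> ags_T L M 1" and "\<gamma> \<equiv> ags_\<gamma> 1"
  shows "0 < lam" "lam \<le> 1" "\<beta> > 0"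
    and "\<And>t. t \<ge> 1 \<Longrightarrow> 0 < \<alpha> t \<and> \<alpha> t \<le> 1"
    and "\<And>t. t \<ge> 1 \<Longrightarrow> 0 \<le> \<beta> * p t + q t"
    and "\<And>t. t \<ge> 1 \<Longrightarrow> M * lam * \<alpha> t \<le> \<nu> * (\<beta> * p t + q t)"
    and "\<And>t. t \<ge> 1 \<Longrightarrow> \<alpha> (Suc t) * (\<beta> * p (Suc t) + q (Suc t))
      = (1 - \<alpha> (Suc t)) * (\<alpha> t * (\<beta> + (\<beta> * p t + q t)))"
    and "\<gamma> = lam * (1 - (\<Prod>s=1..T. 1 - \<alpha> s))"
    and "L * \<gamma> \<le> \<beta> * \<nu>"
    and "real 1 * (real 1 + 1) * (lam * (\<alpha> T * (\<beta> + (\<beta> * p T + q T)))) = 9 * L / \<nu>"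
proof -
  have T: "T \<ge> 1" "8 * M \<le> 7 * L * (real T)\<^sup>2"
    using ags_T_1[OF L M] by (auto simp: T_def)
  define c where "c = 7 * L * real T * (real T + 1) / (4 * \<nu>)"
  have c: "c \<ge> 0"
    using L \<nu> by (simp add: c_def)
  have lam: "lam = 1" and \<beta>: "\<beta> = L / \<nu>" and \<gamma>: "\<gamma> = 1"
    by (simp_all add: lam_def \<beta>_def \<gamma>_def ags_lam_def ags_\<beta>_def ags_\<gamma>_def)
  have \<alpha>: "\<alpha> t = 2 / (real t + 1)" and p: "p t = (real t - 1) / 2" and q: "q t = c / real t" for t
    by (simp_all add: \<alpha>_def p_def q_def c_def T_def ags_\<alpha>_def ags_p_def ags_q_def)
  show "0 < lam" "lam \<le> 1" "\<beta> > 0"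
    using L \<nu> by (simp_all add: lam \<beta>)
  show "0 < \<alpha> t \<and> \<alpha> t \<le> 1" if "t \<ge> 1" for t
    using that by (simp add: \<alpha> field_simps)
  have \<beta>p: "0 \<le> \<beta> * p t" if "t \<ge> 1" for t
    using that L \<nu> by (simp add: \<beta> p)
  then show "0 \<le> \<beta> * p t + q t" if "t \<ge> 1" for t
    using that c by (simp add: q)
  \<comment> \<open>The term \<open>q t\<close> alone covers the curvature, through the choice of
    \<open>T\<close>; \<open>p\<close> vanishes at the first inner step.\<close>
  show "M * lam * \<alpha> t \<le> \<nu> * (\<beta> * p t + q t)" if t: "t \<ge> 1" for t
  proof -
    have "M * lam * \<alpha> t \<le> 2 * M / real t"
      using t M by (simp add: lam \<alpha> field_simps)
    also have "\<dots> \<le> 7 * L * (real T)\<^sup>2 / 4 / real t"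
      using T(2) by (intro divide_right_mono) auto
    also have "\<dots> \<le> \<nu> * c / real t"
    proof -
      have "\<nu> * c = 7 * L * (real T)\<^sup>2 / 4 + 7 * L * real T / 4"
        using \<nu> by (simp add: c_def power2_eq_square field_simps)
      then have "7 * L * (real T)\<^sup>2 / 4 \<le> \<nu> * c"
        using L by simp
      then show ?thesis
        by (intro divide_right_mono) auto
    qed
    also have "\<dots> \<le> \<nu> * (\<beta> * p t + q t)"
      using mult_nonneg_nonneg[OF less_imp_le[OF \<nu>] \<beta>p[OF t]] by (simp add: q distrib_left)
    finally show ?thesis .
  qed
  show "\<alpha> (Suc t) * (\<beta> * p (Suc t) + q (Suc t)) = (1 - \<alpha> (Suc t)) * (\<alpha> t * (\<beta> + (\<beta> * p t + q t)))"
    if t: "t \<ge> 1" for t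
  proof -
    have 1: "1 - \<alpha> (Suc t) = real t / (real t + 2)"
      by (simp add: \<alpha> field_simps)
    have 2: "\<beta> + (\<beta> * p t + q t) = (real t + 1) / 2 * \<beta> + c / real t"
      by (simp add: p q field_simps)
    have 3: "\<beta> * p (Suc t) + q (Suc t) = real t / 2 * \<beta> + c / (real t + 1)"
      by (simp add: p q field_simps)
    show ?thesis
      unfolding 1 2 3 \<alpha> using t by (simp add: divide_simps) (simp add: algebra_simps)
  qed
  \<comment> \<open>The first averaging weight is 1, so the starting point of the loop is forgotten
    at once.\<close>
  have "(\<Prod>s=1..T. 1 - \<alpha> s) = 0"
    using T(1) by (intro prod_zero) (auto simp: \<alpha> intro!: bexI[of _ 1])
  then show "\<gamma> = lam * (1 - (\<Prod>s=1..T. 1 - \<alpha> s))"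
    by (simp add: lam \<gamma>)
  show "L * \<gamma> \<le> \<beta> * \<nu>"
    using \<nu> by (simp add: \<beta> \<gamma>)
  \<comment> \<open>The terms with \<beta> contribute \<open>L / (2 * \<nu>)\<close> and
    \<open>q T\<close> contributes \<open>7 * L / (4 * \<nu>)\<close>, each times
    \<open>T + 1\<close>.\<close>
  have "\<beta> + (\<beta> * p T + q T) = (real T + 1) * (9 * L / (4 * \<nu>))"
    using T(1) \<nu> by (simp add: p q c_def \<beta> field_simps)
  then show "real 1 * (real 1 + 1) * (lam * (\<alpha> T * (\<beta> + (\<beta> * p T + q T)))) = 9 * L / \<nu>"
    by (simp add: lam \<alpha>)
qed

lemma ags_params_later:
  fixes k :: nat
  assumes k: "k \<ge> 2"
  defines "lam \<equiv> ags_lam L M k" and "\<beta> \<equiv> ags_\<beta> L M \<nu> k" and "\<alpha> \<equiv> ags_\<alpha> L M k" and "p \<equiv> ags_p L M k"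
    and "q \<equiv> ags_q L M \<nu> k" and "T \<equiv> ags_T L M k" and "\<gamma> \<equiv> ags_\<gamma> k"
  shows "0 < lam" "lam \<le> 1" "\<beta> > 0"
    and "\<And>t. 0 < \<alpha> t \<and> \<alpha> t \<le> 1"
    and "\<And>t. 0 \<le> \<beta> * p t + q t"
    and "\<And>t. M * lam * \<alpha> t \<le> \<nu> * (\<beta> * p t + q t)"
    and "\<And>t. \<alpha> (Suc t) * (\<beta> * p (Suc t) + q (Suc t))
      = (1 - \<alpha> (Suc t)) * (\<alpha> t * (\<beta> + (\<beta> * p t + q t)))"
    and "\<gamma> = lam * (1 - (\<Prod>s=1..T. 1 - \<alpha> s))"
    and "L * \<gamma> \<le> \<beta> * \<nu>"
    and "real k * (real k + 1) * (lam * (\<alpha> T * (\<beta> + (\<beta> * p T + q T)))) = 9 * L / \<nu>"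
proof -
  define P where "P = sqrt (M / L)"
  have P: "P > 0" and M_eq: "M = P\<^sup>2 * L"
    using L M by (simp_all add: P_def)
  define r where "r = (1 - 1 / (P + 1)) ^ T"
  have r: "r \<le> 1 / 3"
    using ags_T_later[OF L M, of k] k by (simp add: r_def P_def T_def)
  have \<alpha>: "\<alpha> t = 1 / (P + 1)" and p: "p t = P" and q: "q t = 0" for t
    using k by (simp_all add: \<alpha>_def p_def q_def P_def ags_\<alpha>_def ags_p_def ags_q_def)
  have \<gamma>: "\<gamma> = 2 / (real k + 1)"
    by (simp add: \<gamma>_def ags_\<gamma>_def)
  then have \<gamma>0: "\<gamma> > 0"
    by simp
  have lam_eq: "lam = \<gamma> / (1 - r)"
    using k by (simp add: lam_def \<gamma>_def r_def P_def T_def ags_lam_def)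
  then show lam0: "0 < lam"
    using \<gamma>0 r by simp
  \<comment> \<open>The denominator is at least \<open>2 / 3\<close> because the loop contracts by a
    third.\<close>
  have "\<gamma> / (1 - r) \<le> \<gamma> / (2 / 3)"
    using \<gamma>0 r by (intro divide_left_mono) auto
  then have lam3: "lam \<le> 3 / 2 * \<gamma>"
    by (simp add: lam_eq)
  also have "\<dots> \<le> 1"
    using k by (simp add: \<gamma> field_simps)
  finally show "lam \<le> 1" .
  have \<beta>: "\<beta> = 9 * L * \<gamma> / (2 * \<nu> * real k * lam)"
    using k by (simp add: \<beta>_def \<gamma>_def lam_def ags_\<beta>_def)
  then show \<beta>0: "\<beta> > 0"
    using k L \<nu> \<gamma>0 lam0 by simp
  show "0 < \<alpha> t \<and> \<alpha> t \<le> 1" for t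
    using P by (simp add: \<alpha>)
  show "0 \<le> \<beta> * p t + q t" for t
    using \<beta>0 P by (simp add: p q)
  show "\<alpha> (Suc t) * (\<beta> * p (Suc t) + q (Suc t)) = (1 - \<alpha> (Suc t)) * (\<alpha> t * (\<beta> + (\<beta> * p t + q t)))" for t
  proof -
    have "1 - \<alpha> (Suc t) = P / (P + 1)"
      using P by (simp add: \<alpha> field_simps)
    moreover have "\<alpha> t * (\<beta> + (\<beta> * p t + q t)) = \<beta>"
      using P by (simp add: \<alpha> p q field_simps)
    ultimately show ?thesis
      by (simp add: \<alpha> p q)
  qed
  show "\<gamma> = lam * (1 - (\<Prod>s=1..T. 1 - \<alpha> s))"
    using r by (simp add: \<alpha> r_def[symmetric] lam_eq)
  \<comment> \<open>The definition of \<beta> without its quotient; both remaining inequalities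
    follow by comparison with this identity.\<close>
  have \<beta>\<nu>: "\<beta> * \<nu> * (2 * real k * lam) = 9 * L * \<gamma>"
    using k \<nu> lam0 by (simp add: \<beta>)
  have k_lam: "2 * real k * lam \<le> 6"
  proof -
    have "2 * real k * lam \<le> 2 * real k * (3 / 2 * \<gamma>)"
      using lam3 by (intro mult_left_mono) auto
    also have "\<dots> \<le> 6"
      by (simp add: \<gamma> field_simps)
    finally show ?thesis .
  qed
  show "L * \<gamma> \<le> \<beta> * \<nu>"
  proof -
    have "\<beta> * \<nu> * (2 * real k * lam) \<le> \<beta> * \<nu> * 6"
      using k_lam \<beta>0 \<nu> by (intro mult_left_mono) auto
    moreover have "0 < L * \<gamma>"
      using L \<gamma>0 by simp
    ultimately show ?thesis
      unfolding \<beta>\<nu> by linarith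
  qed
  show "M * lam * \<alpha> t \<le> \<nu> * (\<beta> * p t + q t)" for t
  proof -
    have "lam * (2 * real k * lam) \<le> 3 / 2 * \<gamma> * 6"
      using lam3 k_lam lam0 \<gamma>0 by (intro mult_mono) auto
    then have "L * (lam * (2 * real k * lam)) \<le> L * (9 * \<gamma>)"
      using L by (intro mult_left_mono) auto
    also have "\<dots> = (\<beta> * \<nu>) * (2 * real k * lam)"
      using \<beta>\<nu> by simp
    finally have "(L * lam) * (2 * real k * lam) \<le> (\<beta> * \<nu>) * (2 * real k * lam)"
      by (simp only: mult.assoc)
    then have Llam: "L * lam \<le> \<beta> * \<nu>"
      using k lam0 by (simp add: mult_le_cancel_right)
    have "P / (P + 1) \<le> 1"
      using P by simp
    then have "(L * lam) * (P / (P + 1)) \<le> (\<beta> * \<nu>) * 1"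
      using P \<beta>0 \<nu> by (intro mult_mono[OF Llam]) auto
    then have "P * ((L * lam) * (P / (P + 1))) \<le> P * (\<beta> * \<nu>)"
      using P by (intro mult_left_mono) auto
    moreover have "M * lam * \<alpha> t = P * ((L * lam) * (P / (P + 1)))"
      by (simp add: M_eq \<alpha> power2_eq_square)
    ultimately show ?thesis
      by (simp add: p q mult_ac)
  qed
  \<comment> \<open>Since \<alpha> is the reciprocal of \<open>P + 1\<close>, the value \<beta> is a
    fixed point of the inner weights: they do not depend on the number of inner steps.\<close>
  have "\<alpha> T * (\<beta> + (\<beta> * p T + q T)) = \<beta>"
    using P by (simp add: \<alpha> p q field_simps)
  moreover have "lam * \<beta> = 9 * L * \<gamma> / (2 * \<nu> * real k)"
    using lam0 by (simp add: \<beta>)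
  ultimately have "real k * (real k + 1) * (lam * (\<alpha> T * (\<beta> + (\<beta> * p T + q T))))
      = real k * (9 * L * ((real k + 1) * \<gamma>) / (2 * \<nu> * real k))"
    by simp
  also have "(real k + 1) * \<gamma> = 2"
    by (simp add: \<gamma> field_simps)
  finally show "real k * (real k + 1) * (lam * (\<alpha> T * (\<beta> + (\<beta> * p T + q T)))) = 9 * L / \<nu>"
    using k by simp
qed

end

section \<open>The convergence rate of the outer iteration\<close>

context composite
begin

lemma ags_rate:
  fixes f :: "'a \<Rightarrow> real" and Gf :: "'a \<Rightarrow> 'a" and L :: real
  assumes L: "L > 0"
    and f_lower: "\<And>x u. x \<in> X \<Longrightarrow> u \<in> X \<Longrightarrow> 0 \<le> f x - linearization f Gf u x"
    and f_upper: "\<And>x u. x \<in> X \<Longrightarrow> u \<in> X \<Longrightarrow> f x - linearization f Gf u x \<le> L / 2 * (nrm (x - u))\<^sup>2"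
    and pts: "x0 \<in> X" "v \<in> X"
  shows "ags_output X V f Gf h L M \<nu> x0 N \<in> X"
    and "real N * (real N + 1) * (f (ags_output X V f Gf h L M \<nu> x0 N) + h (ags_output X V f Gf h L M \<nu> x0 N) - (f v + h v))
      \<le> 9 * L / \<nu> * V x0 v"
proof -
  define A where "A = ags X V f Gf h x0 ags_\<gamma> (ags_lam L M) (ags_\<beta> L M \<nu>) (ags_T L M)
    (ags_\<alpha> L M) (ags_p L M) (ags_q L M \<nu>)"
  define \<delta> where "\<delta> = (\<lambda>x. f x + h x - (f v + h v))"
  have main: "fst (A k) \<in> X \<and> snd (A k) \<in> X \<and>
    real k * (real k + 1) * \<delta> (snd (A k)) + 9 * L / \<nu> * V (fst (A k)) v \<le> 9 * L / \<nu> * V x0 v" for k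
  proof (induction k)
    case 0
    then show ?case
      using pts by (simp add: A_def)
  next
    case (Suc k)
    obtain x xb where A: "A k = (x, xb)"
      by (cases "A k")
    have x: "x \<in> X" and xb: "xb \<in> X"
      and IH: "real k * (real k + 1) * \<delta> xb + 9 * L / \<nu> * V x v \<le> 9 * L / \<nu> * V x0 v"
      using Suc by (auto simp: A)
    let ?j = "Suc k"
    define lam \<beta> \<alpha> p q T \<gamma> where defs: "lam = ags_lam L M ?j" "\<beta> = ags_\<beta> L M \<nu> ?j" "\<alpha> = ags_\<alpha> L M ?j"
      "p = ags_p L M ?j" "q = ags_q L M \<nu> ?j" "T = ags_T L M ?j" "\<gamma> = ags_\<gamma> ?j"
    define \<kappa> where "\<kappa> = \<alpha> T * (\<beta> + (\<beta> * p T + q T))"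
    have "0 < lam \<and> lam \<le> 1 \<and> \<beta> > 0 \<and>
      (\<forall>t\<ge>1. 0 < \<alpha> t \<and> \<alpha> t \<le> 1) \<and> (\<forall>t\<ge>1. 0 \<le> \<beta> * p t + q t) \<and>
      (\<forall>t\<ge>1. M * lam * \<alpha> t \<le> \<nu> * (\<beta> * p t + q t)) \<and>
      (\<forall>t\<ge>1. \<alpha> (Suc t) * (\<beta> * p (Suc t) + q (Suc t))
        = (1 - \<alpha> (Suc t)) * (\<alpha> t * (\<beta> + (\<beta> * p t + q t)))) \<and>
      \<gamma> = lam * (1 - (\<Prod>s=1..T. 1 - \<alpha> s)) \<and> L * \<gamma> \<le> \<beta> * \<nu> \<and>
      real ?j * (real ?j + 1) * (lam * \<kappa>) = 9 * L / \<nu>"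
    proof (cases "k = 0")
      case True
      then have j: "?j = 1"
        by simp
      show ?thesis
        unfolding defs \<kappa>_def j by (intro conjI allI impI ags_params_first[OF L M \<nu>])
    next
      case False
      then have j: "?j \<ge> 2"
        by simp
      show ?thesis
        unfolding defs \<kappa>_def by (intro conjI allI impI ags_params_later[OF L M \<nu> j])
    qed
    then have params: "0 < lam" "lam \<le> 1" "\<beta> > 0"
      "\<And>t. t \<ge> 1 \<Longrightarrow> 0 < \<alpha> t \<and> \<alpha> t \<le> 1"
      "\<And>t. t \<ge> 1 \<Longrightarrow> 0 \<le> \<beta> * p t + q t"
      "\<And>t. t \<ge> 1 \<Longrightarrow> M * lam * \<alpha> t \<le> \<nu> * (\<beta> * p t + q t)"
      "\<And>t. t \<ge> 1 \<Longrightarrow> \<alpha> (Suc t) * (\<beta> * p (Suc t) + q (Suc t))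
        = (1 - \<alpha> (Suc t)) * (\<alpha> t * (\<beta> + (\<beta> * p t + q t)))"
      "\<gamma> = lam * (1 - (\<Prod>s=1..T. 1 - \<alpha> s))" "L * \<gamma> \<le> \<beta> * \<nu>"
      "real ?j * (real ?j + 1) * (lam * \<kappa>) = 9 * L / \<nu>"
      by blast+
    have \<gamma>: "0 \<le> \<gamma>" "\<gamma> \<le> 1" "\<gamma> = 2 / (real ?j + 1)"
      by (simp_all add: defs ags_\<gamma>_def)
    let ?P = "prox_ag X V h (linearization f Gf ((1 - \<gamma>) *\<^sub>R xb + \<gamma> *\<^sub>R x)) xb x lam \<beta> \<alpha> p q T"
    let ?xb' = "(1 - lam) *\<^sub>R xb + lam *\<^sub>R snd ?P"
    have AS: "A ?j = (fst ?P, ?xb')"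
      using A by (simp add: A_def Let_def defs split_beta)
    note step = outer_step[OF L f_lower f_upper xb x pts(2) params(1-8) \<gamma>(1,2) params(9), folded \<kappa>_def]
    have "real ?j * (real ?j + 1) * (\<delta> ?xb' + lam * \<kappa> * V (fst ?P) v)
        \<le> real ?j * (real ?j + 1) * ((1 - \<gamma>) * \<delta> xb + lam * \<kappa> * V x v)"
      unfolding \<delta>_def using step(3) by (intro mult_left_mono) auto
    \<comment> \<open>This matches the weight of the old gap to the previous potential. It is 0 for
      \<open>k = 0\<close>, so the initial gap leaves no trace in the rate.\<close>
    moreover have "real ?j * (real ?j + 1) * (1 - \<gamma>) = real k * (real k + 1)"
      by (simp add: \<gamma>(3) field_simps)
    ultimately have "real ?j * (real ?j + 1) * \<delta> ?xb' + 9 * L / \<nu> * V (fst ?P) v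
        \<le> real k * (real k + 1) * \<delta> xb + 9 * L / \<nu> * V x v"
      by (simp only: distrib_left mult.assoc[symmetric] params(10)[symmetric])
    then show ?case
      unfolding AS fst_conv snd_conv using IH step(1,2) by simp
  qed
  have out: "ags_output X V f Gf h L M \<nu> x0 N = snd (A N)"
    by (simp add: ags_output_def A_def)
  show "ags_output X V f Gf h L M \<nu> x0 N \<in> X"
    unfolding out using main by blast
  have "0 \<le> 9 * L / \<nu> * V (fst (A N)) v"
    using V_nonneg[of "fst (A N)" v] main[of N] pts(2) L \<nu> by simp
  then show "real N * (real N + 1) * (f (ags_output X V f Gf h L M \<nu> x0 N) + h (ags_output X V f Gf h L M \<nu> x0 N) - (f v + h v))
      \<le> 9 * L / \<nu> * V x0 v"
    unfolding out using main[of N] by (simp add: \<delta>_def)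
qed

end

section \<open>Counting evaluations\<close>

lemma op_evals_le:
  assumes "L > 0" "L \<le> M"
  shows "real (op_evals (ags_T L M) N) \<le> 82 / 25 * real N * (sqrt (M / L) + 1)"
proof -
  have "real (op_evals (ags_T L M) N) = (\<Sum>k=1..N. 2 * real (ags_T L M k))"
    by (simp add: op_evals_def mult.commute)
  also have "\<dots> \<le> (\<Sum>k=1..N. 2 * (41 / 25 * (sqrt (M / L) + 1)))"
    using ags_T_le[OF assms] by (intro sum_mono mult_left_mono) auto
  also have "\<dots> = 82 / 25 * real N * (sqrt (M / L) + 1)"
    by (simp add: algebra_simps)
  finally show ?thesis .
qed

text \<open>\<open>P N\<close> is to be read as: the \<open>N\<close>-th output is accurate enough.\<close>

lemma iteration_count:
  fixes s :: real and P :: "nat \<Rightarrow> bool"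
  assumes L: "L > 0" "L \<le> M" and s: "s \<ge> 0"
    and good: "\<And>N. 9 * s\<^sup>2 \<le> real N * (real N + 1) \<Longrightarrow> P N"
  defines "c \<equiv> 14 * (s * (sqrt (M / L) + 1))"
  shows "(\<exists>N. P N \<and> int (f_evals N) \<le> \<lceil>3 * s\<rceil> \<and> (real (op_evals (ags_T L M) N) \<le> c \<or> N = 1 \<and> 3 * s < 1))
    \<and> (\<forall>N. 3 * s \<le> real (f_evals N) \<longrightarrow> P N) \<and> (\<forall>N. c \<le> real (op_evals (ags_T L M) N) \<longrightarrow> P N)"
proof (intro conjI allI impI)
  let ?p = "sqrt (M / L) + 1"
  have p: "?p > 0"
    using L by (intro add_nonneg_pos) auto
  have sq: "9 * s\<^sup>2 \<le> real N * (real N + 1)" if "3 * s \<le> real N" for N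
  proof -
    have "(3 * s)\<^sup>2 \<le> (real N)\<^sup>2"
      using that s by (intro power_mono) auto
    then show ?thesis
      by (simp add: power2_eq_square algebra_simps)
  qed
  show "P N" if "3 * s \<le> real (f_evals N)" for N
    using that by (intro good sq) (simp add: f_evals_def)
  show "P N" if "c \<le> real (op_evals (ags_T L M) N)" for N
  proof (rule good[OF sq])
    \<comment> \<open>An operator budget of \<open>c\<close> forces \<open>N\<close> to be at least
      \<open>(175 / 41) * s\<close>, which exceeds what accuracy requires.\<close>
    have "14 * s * ?p \<le> 82 / 25 * real N * ?p"
      using that op_evals_le[OF L, of N] unfolding c_def by (simp only: mult.assoc)
    then have "14 * s \<le> 82 / 25 * real N"
      using p by (simp only: mult_le_cancel_right_pos)
    then show "3 * s \<le> real N"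
      by simp
  qed
  \<comment> \<open>The least sufficient number of iterations, not the rounded value of
    \<open>3 * s\<close>, is what keeps the operator count within \<open>c\<close>.\<close>
  define N where "N = (LEAST N. 9 * s\<^sup>2 \<le> real N * (real N + 1))"
  have ceil: "9 * s\<^sup>2 \<le> real (nat \<lceil>3 * s\<rceil>) * (real (nat \<lceil>3 * s\<rceil>) + 1)"
    by (rule sq) linarith
  then have N: "9 * s\<^sup>2 \<le> real N * (real N + 1)"
    unfolding N_def by (rule LeastI)
  have "N \<le> nat \<lceil>3 * s\<rceil>"
    unfolding N_def using ceil by (rule Least_le)
  then have "int N \<le> \<lceil>3 * s\<rceil>"
    using s by (simp add: le_nat_iff)
  moreover have "real (op_evals (ags_T L M) N) \<le> c \<or> N = 1 \<and> 3 * s < 1"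
  proof -
    have "82 / 25 * real N \<le> 14 * s \<or> N = 1 \<and> 3 * s < 1"
    proof (cases "N \<le> 1")
      case True
      then show ?thesis
        using s by (cases N) auto
    next
      case False
      \<comment> \<open>Minimality and \<open>N - 1 \<ge> N / 2\<close> give
        \<open>N * N < 18 * s\<^sup>2\<close>; then 18 times the square of \<open>82 / 25\<close>
        stays below 196.\<close>
      then have "\<not> 9 * s\<^sup>2 \<le> real (N - 1) * (real (N - 1) + 1)"
        unfolding N_def by (intro not_less_Least) (simp flip: N_def)
      then have "real N * (real N - 1) < 9 * s\<^sup>2"
        using False by (simp add: mult.commute of_nat_diff)
      moreover have "real N * (real N / 2) \<le> real N * (real N - 1)"
        using False by (intro mult_left_mono) auto
      moreover have "(82 / 25 * real N)\<^sup>2 = 6724 / 625 * (real N * real N)" "(14 * s)\<^sup>2 = 196 * s\<^sup>2"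
        by (simp_all add: power2_eq_square)
      ultimately have "(82 / 25 * real N)\<^sup>2 \<le> (14 * s)\<^sup>2"
        using zero_le_power2[of s] by argo
      then have "82 / 25 * real N \<le> 14 * s"
        by (rule power2_le_imp_le) (use s in simp)
      then show ?thesis ..
    qed
    moreover have "real (op_evals (ags_T L M) N) \<le> c" if "82 / 25 * real N \<le> 14 * s"
    proof -
      have "82 / 25 * real N * ?p \<le> 14 * s * ?p"
        using that p by (intro mult_right_mono) auto
      then show ?thesis
        using op_evals_le[OF L, of N] unfolding c_def by (simp only: mult.assoc)
    qed
    ultimately show ?thesis
      by blast
  qed
  ultimately show "\<exists>N. P N \<and> int (f_evals N) \<le> \<lceil>3 * s\<rceil> \<and> (real (op_evals (ags_T L M) N) \<le> c \<or> N = 1 \<and> 3 * s < 1)"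
    using good[OF N] by (intro exI[of _ N]) (simp add: f_evals_def)
qed

text \<open>Counts are integers, so the existence claim rounds \<open>N_f\<close> up, and it needs
  the exception for \<open>N_f < 1\<close>: \<open>N_K\<close> may be arbitrarily close to 0, yet a
  single outer iteration already costs a fixed number of operator evaluations. The two universal
  claims say that spending either budget in full guarantees accuracy.\<close>

theorem proposition2:
  fixes X :: "'a::euclidean_space set" and Y :: "'b::euclidean_space set"
    and normX :: "'a \<Rightarrow> real" and normY :: "'b \<Rightarrow> real"
    and K :: "'a \<Rightarrow> 'b" and J :: "'b \<Rightarrow> real"
    and f :: "'a \<Rightarrow> real" and Gf :: "'a \<Rightarrow> 'a" and L :: real
    and V :: "'a \<Rightarrow> 'a \<Rightarrow> real" and W :: "'b \<Rightarrow> 'b \<Rightarrow> real" and \<nu> \<omega> :: real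
    and y0 :: 'b and \<Omega> \<epsilon> \<rho> M :: real
    and h :: "'a \<Rightarrow> real" and x0 xstar :: 'a
    and xbar :: "nat \<Rightarrow> 'a" and N_f N_K :: real
  assumes "is_norm normX" and "is_norm normY"
    and "closed X" and "convex X" and "closed Y" and "convex Y"
    and "linear K" and "convex_on Y J"
    and "convex_on X f" and "has_gradient_on f Gf X" and "continuous_on X Gf"
    and "L > 0"
    and "\<forall>x\<in>X. \<forall>u\<in>X. 0 \<le> f x - linearization f Gf u x \<and>
           f x - linearization f Gf u x \<le> L / 2 * (normX (x - u))\<^sup>2"
    and "\<nu> > 0" and "prox_function normX X \<nu> V"
    and "\<omega> > 0" and "prox_function normY Y \<omega> W"
    and "y0 \<in> Y" and "bdd_above (W y0 ` Y)" and "\<Omega> = (SUP v\<in>Y. W y0 v)"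
    and "\<epsilon> > 0" and "2 * (op_norm normX normY K)\<^sup>2 * \<Omega> > \<epsilon> * \<omega> * L"
    and "\<rho> = \<epsilon> / (2 * \<Omega>)" and "M = (op_norm normX normY K)\<^sup>2 / (\<rho> * \<omega>)"
    and "h = smoothed_max K J Y W y0 \<rho>"
    and "is_minimizer (\<lambda>x. f x + h x) X xstar"
    and "x0 \<in> X" and "xbar = ags_output X V f Gf h L M \<nu> x0"
    and "N_f = 3 * sqrt (2 * L * V x0 xstar / (\<nu> * \<epsilon>))"
    and "N_K = 14 * (sqrt (2 * L * V x0 xstar / (\<nu> * \<epsilon>)) +
           2 * op_norm normX normY K * sqrt (V x0 xstar * \<Omega>) / (sqrt (\<nu> * \<omega>) * \<epsilon>))"
  shows "(\<exists>N. eps_solution (saddle_objective f K J Y) X \<epsilon> (xbar N) \<and>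
            int (f_evals N) \<le> \<lceil>N_f\<rceil> \<and>
            (real (op_evals (ags_T L M) N) \<le> N_K \<or> N = 1 \<and> N_f < 1)) \<and>
         (\<forall>N. N_f \<le> real (f_evals N) \<longrightarrow>
            eps_solution (saddle_objective f K J Y) X \<epsilon> (xbar N)) \<and>
         (\<forall>N. N_K \<le> real (op_evals (ags_T L M) N) \<longrightarrow>
            eps_solution (saddle_objective f K J Y) X \<epsilon> (xbar N))"
proof -
  let ?k = "op_norm normX normY K"
  note nX = assms(1) and nY = assms(2) and X = assms(3,4) and Y = assms(5,6) and K = assms(7)
    and J = assms(8) and L = \<open>L > 0\<close> and f = assms(13) and \<nu> = \<open>\<nu> > 0\<close> and V = assms(15)
    and \<omega> = \<open>\<omega> > 0\<close> and W = assms(17) and y0 = \<open>y0 \<in> Y\<close> and bddW = assms(19) and \<Omega>_def = assms(20)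
    and \<epsilon> = \<open>\<epsilon> > 0\<close> and big = assms(22) and \<rho>_def = assms(23) and M_def = assms(24)
    and h_def = assms(25) and xstar = assms(26) and x0 = assms(27) and xbar = assms(28)
  have \<Omega>: "W y0 y \<le> \<Omega>" if "y \<in> Y" for y
    unfolding \<Omega>_def using that bddW by (rule cSUP_upper)
  have k0: "?k \<ge> 0"
    by (rule op_norm_bound(1)[OF nX nY K])
  have "0 < \<epsilon> * \<omega> * L"
    using \<epsilon> \<omega> L by simp
  then have "0 < 2 * ?k\<^sup>2 * \<Omega>"
    using big by linarith
  then have \<Omega>0: "\<Omega> > 0" and k: "?k \<noteq> 0"
    by (auto simp: zero_less_mult_iff)
  have \<rho>: "\<rho> > 0"
    using \<epsilon> \<Omega>0 by (simp add: \<rho>_def)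
  have M_eq: "M = 2 * ?k\<^sup>2 * \<Omega> / (\<epsilon> * \<omega>)"
    using \<epsilon> \<Omega>0 by (simp add: M_def \<rho>_def)
  \<comment> \<open>This is the assumption on \<epsilon> in disguise; it enters through the bound on
    the inner loop lengths.\<close>
  then have LM: "L \<le> M"
    using big \<epsilon> \<omega> by (simp add: pos_le_divide_eq mult_ac)
  then have M: "M > 0"
    using L by linarith
  have smoothed: "bdd_above ((\<lambda>y. K x \<bullet> y - (J y + \<rho> * W y0 y)) ` Y)"
    "smoothed_max K J Y W y0 \<rho> x \<le> (SUP y\<in>Y. K x \<bullet> y - J y)"
    "(SUP y\<in>Y. K x \<bullet> y - J y) \<le> smoothed_max K J Y W y0 \<rho> x + \<rho> * \<Omega>" for x
    by (rule smoothed_max_bounds[OF nY Y(2) J W \<omega> y0 \<rho>]; erule \<Omega>)+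
  have h_eq: "h = (\<lambda>x. SUP y\<in>Y. K x \<bullet> y - (J y + \<rho> * W y0 y))"
    by (simp add: h_def smoothed_max_def diff_diff_eq fun_eq_iff)
  have h_app: "(SUP y\<in>Y. K x \<bullet> y - (J y + \<rho> * W y0 y)) = h x" for x
    by (simp add: h_eq)
  \<comment> \<open>The convex \<open>J\<close> adds no modulus and \<open>W y0\<close> contributes
    \<open>\<rho> * \<omega>\<close>, so the conjugate is smooth with constant
    \<open>M\<close>.\<close>
  have sc: "strongly_convex_on normY (\<rho> * \<omega>) Y (\<lambda>y. J y + \<rho> * W y0 y)"
    unfolding strongly_convex_on_def
  proof (intro ballI)
    fix x y and t :: real assume xy: "x \<in> Y" "y \<in> Y" "t \<in> {0..1}"
    have "J (t *\<^sub>R x + (1 - t) *\<^sub>R y) \<le> t * J x + (1 - t) * J y"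
      using convex_onD[OF J, of "1 - t" x y] xy by simp
    moreover have "\<rho> * W y0 (t *\<^sub>R x + (1 - t) *\<^sub>R y)
        \<le> \<rho> * (t * W y0 x + (1 - t) * W y0 y - \<omega> / 2 * t * (1 - t) * (normY (x - y))\<^sup>2)"
      using prox_function_strongly_convex[OF W y0 Y(2)] xy \<rho> unfolding strongly_convex_on_def
      by (intro mult_left_mono) auto
    ultimately show "J (t *\<^sub>R x + (1 - t) *\<^sub>R y) + \<rho> * W y0 (t *\<^sub>R x + (1 - t) *\<^sub>R y)
        \<le> t * (J x + \<rho> * W y0 x) + (1 - t) * (J y + \<rho> * W y0 y)
          - \<rho> * \<omega> / 2 * t * (1 - t) * (normY (x - y))\<^sup>2"
      by (simp add: algebra_simps)
  qed
  have "Y \<noteq> {}" "\<rho> * \<omega> > 0"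
    using y0 \<rho> \<omega> by auto
  note smooth = conjugate_smooth[where K = K and Y = Y, OF nX nY K Y this sc smoothed(1),
      folded h_eq M_def, unfolded h_app]
  interpret composite normX X \<nu> V h M
    using nX X \<nu> V M smooth by unfold_locales
  have xs: "xstar \<in> X" "\<And>z. z \<in> X \<Longrightarrow> f xstar + h xstar \<le> f z + h z"
    using xstar by (auto simp: is_minimizer_def)
  \<comment> \<open>Smoothing underestimates the objective by at most
    \<open>\<rho> * \<Omega> = \<epsilon> / 2\<close>, leaving the other half for the optimisation
    error.\<close>
  have eps: "eps_solution (saddle_objective f K J Y) X \<epsilon> z"
    if z: "z \<in> X" "f z + h z - (f xstar + h xstar) \<le> \<epsilon> / 2" for z
  proof -
    have "f xstar + h xstar \<le> (INF z\<in>X. saddle_objective f K J Y z)"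
    proof (rule cINF_greatest)
      fix w assume "w \<in> X"
      then show "f xstar + h xstar \<le> saddle_objective f K J Y w"
        using xs(2)[of w] smoothed(2)[of w] by (simp add: saddle_objective_def h_def)
    qed (use z in auto)
    moreover have "saddle_objective f K J Y z \<le> f z + h z + \<epsilon> / 2"
      using smoothed(3)[of z] \<Omega>0 by (simp add: saddle_objective_def h_def \<rho>_def)
    ultimately show ?thesis
      using z by (simp add: eps_solution_def)
  qed
  let ?s = "sqrt (2 * L * V x0 xstar / (\<nu> * \<epsilon>))"
  have V0: "0 \<le> V x0 xstar"
    by (rule V_nonneg[OF x0 xs(1)])
  have s2: "?s\<^sup>2 = 2 * L * V x0 xstar / (\<nu> * \<epsilon>)"
    using V0 L \<nu> \<epsilon> by simp
  have s0: "?s \<ge> 0"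
    using V0 L \<nu> \<epsilon> by simp
  have good: "eps_solution (saddle_objective f K J Y) X \<epsilon> (xbar N)"
    if N: "9 * ?s\<^sup>2 \<le> real N * (real N + 1)" for N
  proof -
    have xN: "xbar N \<in> X" and
      rate: "real N * (real N + 1) * (f (xbar N) + h (xbar N) - (f xstar + h xstar)) \<le> 9 * L / \<nu> * V x0 xstar"
      using ags_rate[OF L _ _ x0 xs(1), where f = f and Gf = Gf and N = N] f by (simp_all add: xbar)
    show ?thesis
    proof (cases "N = 0")
      \<comment> \<open>With no iterations the criterion forces \<open>V x0 xstar = 0\<close>, so
        the starting point is already the smoothed minimiser.\<close>
      case True
      then have "V x0 xstar = 0"
        using N s2 V0 L \<nu> \<epsilon> by (simp add: field_simps mult_le_0_iff)
      then have "(normX (x0 - xstar))\<^sup>2 \<le> 0"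
        using V_lower[OF x0 xs(1)] \<nu> by (simp add: mult_le_0_iff)
      then have "x0 = xstar"
        using nX by (simp add: is_norm_def)
      moreover have "xbar N = x0"
        using True by (simp add: xbar ags_output_def)
      ultimately show ?thesis
        using eps[OF xN] \<epsilon> by simp
    next
      case False
      then have pos: "0 < real N * (real N + 1)"
        by simp
      have "real N * (real N + 1) * (f (xbar N) + h (xbar N) - (f xstar + h xstar)) \<le> 9 * ?s\<^sup>2 * (\<epsilon> / 2)"
        using rate \<epsilon> \<nu> unfolding s2 by (simp add: field_simps)
      also have "\<dots> \<le> real N * (real N + 1) * (\<epsilon> / 2)"
        using N \<epsilon> by (intro mult_right_mono) auto
      finally show ?thesis
        using pos by (intro eps[OF xN]) (simp only: mult_le_cancel_left_pos)
    qed
  qed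
  \<comment> \<open>The second summand of \<open>N_K\<close> is \<open>?s * sqrt (M / L)\<close>, as
    substituting the value of \<open>M\<close> shows.\<close>
  have "2 * ?k * sqrt (V x0 xstar * \<Omega>) / (sqrt (\<nu> * \<omega>) * \<epsilon>) = sqrt ((2 * ?k / \<epsilon>)\<^sup>2 * (V x0 xstar * \<Omega>) / (\<nu> * \<omega>))"
    using k0 \<epsilon> by (simp only: real_sqrt_divide real_sqrt_mult real_sqrt_abs) simp
  also have "(2 * ?k / \<epsilon>)\<^sup>2 * (V x0 xstar * \<Omega>) / (\<nu> * \<omega>) = 2 * L * V x0 xstar / (\<nu> * \<epsilon>) * (M / L)"
    using L \<epsilon> \<nu> \<omega> by (simp add: M_eq power2_eq_square mult_ac)
  also have "sqrt \<dots> = ?s * sqrt (M / L)"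
    by (rule real_sqrt_mult)
  finally have NK: "N_K = 14 * (?s * (sqrt (M / L) + 1))"
    unfolding assms(30) by (simp only: distrib_left)
  show ?thesis
    unfolding NK assms(29) by (rule iteration_count[OF L LM s0 good])
qed

end
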